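(* Let $n,m\ge 1$ and let $G$ be a quantum XOR game on $\mathbb{C}^n\otimes\mathbb{C}^m$, that is, a selfadjoint element $G\in S_1^{n,\mathrm{sa}}\otimes S_1^{m,\mathrm{sa}}\subset S_1^n\otimes S_1^m$ with $\|G\|_{S_1^{nm}}\le 1$. Then $$\beta_{owc}(G)\leq \pi_{1,cb}(\hat{G}:S_\infty^n\rightarrow S_1^m)\leq 4\, \beta_{owc}(G).$$
   Context: $S_\infty^k$ and $S_1^k$ denote the space $M_k$ of complex $k\times k$ matrices with the operator norm and the trace norm respectively, and the superscript $\mathrm{sa}$ denotes the real subspace of selfadjoint matrices. $S_\infty^n=M_n$ has its operator space structure as a C$^*$-algebra. A quantum XOR game is given by states $\rho_x$ on $\mathbb{C}^n\otimes\mathbb{C}^m$, signs $c_x\in\{\pm1\}$ and probabilities $p_x$ ($1\le x\le N$), and is identified with the operator $G=\sum_x c_xp_x\rho_x$; the operators arising in this way are identified with the selfadjoint $G$ on $\mathbb{C}^n\otimes\mathbb{C}^m$ with $\|G\|_{S_1^{nm}}\le1$. The linear map $\hat G:S_\infty^n\to S_1^m$ associated with $G$ is $\hat{G}(x)=(\mathrm{tr}\otimes \mathrm{id}_{M_m})\big(G(x^T\otimes 1_{M_m})\big)$, where $x^T$ is the transpose. The one-way classical communication bias is $$\beta_{owc}(G)=\sup\ \sum_{k=1}^{2^c}\mathrm{tr}\big((A_k\otimes B_k)G\big),\qquad A_k=E_{1,k}-E_{-1,k},\quad B_k=F_{1,k}-F_{-1,k},$$ where the supremum runs over all $c\in\mathbb{N}$,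 all families of positive semidefinite operators $\{E_{a,k}\}_{a=\pm1,\,1\le k\le 2^c}$ on $\mathbb{C}^n$ with $\sum_{a,k}E_{a,k}=1_{M_n}$, and all families of positive semidefinite operators $\{F_{b,k}\}_{b=\pm1,\,1\le k\le 2^c}$ on $\mathbb{C}^m$ with $\sum_bF_{b,k}=1_{M_m}$ for every $k$. For an operator space $X$, a Banach space $Y$ and a linear map $T:X\to Y$, $$\pi_{1,cb}(T)=\|\mathrm{id}\otimes T:\ell_1\otimes_{\min}X\rightarrow \ell_1(Y)\|,$$ where $\ell_1$ has its natural operator space structure (as operator space dual of $c_0$), $\otimes_{\min}$ is the minimal tensor product of operator spaces, and $\ell_1(Y)$ is the space of absolutely summable $Y$-valued sequences. *)

theory Defs
  imports "HOL-Analysis.Analysis" "HOL-Library.Function_Algebras"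
begin

text \<open>
  Matrices of fixed size are elements of \<open>complex^'n^'n\<close>; the size \<open>n = CARD('n) \<ge> 1\<close> is
  arbitrary, and \<open>\<complex>\<^sup>n \<otimes> \<complex>\<^sup>m\<close> is indexed by \<open>'n \<times> 'm\<close>.  Note that the type class norm on
  \<open>complex^'n^'n\<close> is the Frobenius norm, which is not used here.  Operator space structures
  quantify over all matrix sizes; there a matrix is a function of its two indices, restricted
  to a finite index set, and the index set of a tensor product is the product of the index
  sets.
\<close>


subsection \<open>Matrices\<close>

definition cscale :: "complex \<Rightarrow> complex^'n^'m \<Rightarrow> complex^'n^'m" where
  "cscale c A = (\<chi> i j. c * A $ i $ j)"

definition adjoint_mat :: "complex^'n^'m \<Rightarrow> complex^'m^'n" where
  "adjoint_mat A = (\<chi> i j. cnj (A $ j $ i))"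

definition selfadjoint :: "complex^'n^'n \<Rightarrow> bool" where
  "selfadjoint A \<longleftrightarrow> adjoint_mat A = A"

definition psd :: "complex^'n^'n \<Rightarrow> bool" where
  "psd A \<longleftrightarrow> selfadjoint A \<and>
     (\<forall>v :: complex^'n. 0 \<le> Re (\<Sum>i\<in>UNIV. \<Sum>j\<in>UNIV. cnj (v $ i) * A $ i $ j * v $ j))"

text \<open>The absolute value \<open>(A\<^sup>* A)\<^bsup>1/2\<^esup>\<close>: the unique positive square root.\<close>

definition abs_mat :: "complex^'n^'n \<Rightarrow> complex^'n^'n" where
  "abs_mat A = (THE P. psd P \<and> P ** P = adjoint_mat A ** A)"

definition trace_norm :: "complex^'n^'n \<Rightarrow> real" where
  "trace_norm A = Re (trace (abs_mat A))"

definition tensor_mat :: "complex^'n^'n \<Rightarrow> complex^'m^'m \<Rightarrow> complex^('n \<times> 'm)^('n \<times> 'm)" where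
  "tensor_mat A B = (\<chi> r s. A $ fst r $ fst s * B $ snd r $ snd s)"

text \<open>\<open>tr \<otimes> id\<close>\<close>

definition partial_trace :: "complex^('n::finite \<times> 'm::finite)^('n \<times> 'm) \<Rightarrow> complex^'m^'m" where
  "partial_trace H = (\<chi> k l. \<Sum>i\<in>UNIV. H $ (i, k) $ (i, l))"

text \<open>The operator norm of a matrix \<open>A\<close> on the Hilbert space \<open>\<ell>\<^sub>2(I)\<close>, for a finite index set \<open>I\<close>;
  only the entries with both indices in \<open>I\<close> matter.\<close>

definition op_norm :: "'i set \<Rightarrow> ('i \<Rightarrow> 'i \<Rightarrow> complex) \<Rightarrow> real" where
  "op_norm I A = Sup {sqrt (\<Sum>i\<in>I. (cmod (\<Sum>j\<in>I. A i j * v j))\<^sup>2) | v.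
                        (\<Sum>j\<in>I. (cmod (v j))\<^sup>2) \<le> 1}"


subsection \<open>Operator spaces\<close>

text \<open>
  An operator space: a complex linear subspace (\<open>os_carrier\<close>) of a type, with its scalar
  multiplication and a norm on \<open>d \<times> d\<close> matrices over it for every \<open>d\<close>.  A \<open>d \<times> d\<close> matrix over the
  space is a function on \<open>nat \<times> nat\<close> of which only the entries with indices below \<open>d\<close> matter.
  All norms defined as suprema take values in the extended reals, so that an unbounded
  supremum is \<open>\<infinity>\<close>.
\<close>

record 'x operator_space =
  os_carrier :: "'x set"
  os_scale :: "complex \<Rightarrow> 'x \<Rightarrow> 'x"
  os_norm :: "nat \<Rightarrow> (nat \<Rightarrow> nat \<Rightarrow> 'x) \<Rightarrow> ereal"

definition os_mat :: "'x operator_space \<Rightarrow> nat \<Rightarrow> (nat \<Rightarrow> nat \<Rightarrow> 'x) set" where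
  "os_mat X d = {x. \<forall>i<d. \<forall>j<d. x i j \<in> os_carrier X}"

text \<open>Linear maps from \<open>X\<close> to \<open>M\<^sub>p\<close>\<close>

definition os_linear :: "'x::plus operator_space \<Rightarrow> nat \<Rightarrow> ('x \<Rightarrow> nat \<Rightarrow> nat \<Rightarrow> complex) \<Rightarrow> bool" where
  "os_linear X p \<phi> \<longleftrightarrow> (\<forall>k<p. \<forall>l<p.
     (\<forall>x\<in>os_carrier X. \<forall>y\<in>os_carrier X. \<phi> (x + y) k l = \<phi> x k l + \<phi> y k l) \<and>
     (\<forall>c. \<forall>x\<in>os_carrier X. \<phi> (os_scale X c x) k l = c * \<phi> x k l))"

text \<open>The cb norm of \<open>\<phi> : X \<rightarrow> M\<^sub>p\<close>, the supremum of the norms of the amplifications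
  \<open>M\<^sub>d(X) \<rightarrow> M\<^sub>d(M\<^sub>p)\<close>.\<close>

definition cb_norm :: "'x operator_space \<Rightarrow> nat \<Rightarrow> ('x \<Rightarrow> nat \<Rightarrow> nat \<Rightarrow> complex) \<Rightarrow> ereal" where
  "cb_norm X p \<phi> =
     Sup {ereal (op_norm ({..<d} \<times> {..<p}) (\<lambda>(i, k) (j, l). \<phi> (x i j) k l)) | d x.
            x \<in> os_mat X d \<and> os_norm X d x \<le> 1}"

definition complete_contractions ::
    "'x::plus operator_space \<Rightarrow> nat \<Rightarrow> ('x \<Rightarrow> nat \<Rightarrow> nat \<Rightarrow> complex) set" where
  "complete_contractions X p = {\<phi>. os_linear X p \<phi> \<and> cb_norm X p \<phi> \<le> 1}"

text \<open>\<open>S\<^sub>\<infinity>\<^sup>n = M\<^sub>n\<close> as a C*-algebra: \<open>M\<^sub>d(M\<^sub>n)\<close> acts on \<open>\<complex>\<^sup>d \<otimes> \<complex>\<^sup>n\<close>.\<close>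

definition S_inf :: "(complex^'n::finite^'n) operator_space" where
  "S_inf = \<lparr>os_carrier = UNIV, os_scale = cscale,
     os_norm = (\<lambda>d x. ereal (op_norm ({..<d} \<times> UNIV) (\<lambda>(i, k) (j, l). x i j $ k $ l)))\<rparr>"

text \<open>\<open>c\<^sub>0\<close> as a commutative C*-algebra: the norm of \<open>M\<^sub>d(c\<^sub>0) = c\<^sub>0(M\<^sub>d)\<close> is the supremum norm.\<close>

definition c0_space :: "(nat \<Rightarrow> complex) operator_space" where
  "c0_space = \<lparr>os_carrier = {f. f \<longlonglongrightarrow> 0}, os_scale = (\<lambda>c f k. c * f k),
     os_norm = (\<lambda>d f. SUP k. ereal (op_norm {..<d} (\<lambda>i j. f i j k)))\<rparr>"

text \<open>\<open>\<ell>\<^sub>1\<close> as the operator space dual of \<open>c\<^sub>0\<close>: through the pairing \<open>\<langle>a, f\<rangle> = \<Sum>\<^sub>k a\<^sub>k f\<^sub>k\<close>, a matrix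
  over \<open>\<ell>\<^sub>1\<close> is a map \<open>c\<^sub>0 \<rightarrow> M\<^sub>d\<close>, and its norm is the cb norm of that map.\<close>

definition l1_space :: "(nat \<Rightarrow> complex) operator_space" where
  "l1_space = \<lparr>os_carrier = {a. summable (\<lambda>k. cmod (a k))}, os_scale = (\<lambda>c a k. c * a k),
     os_norm = (\<lambda>d a. cb_norm c0_space d (\<lambda>f i j. \<Sum>k. a i j k * f k))\<rparr>"


subsection \<open>The minimal tensor product and the summing norm\<close>

text \<open>
  An element of the algebraic tensor product of \<open>X\<close> and \<open>Y\<close> is represented by a finite list of
  pairs, \<open>t = [(x\<^sub>1, y\<^sub>1), \<dots>]\<close> standing for \<open>\<Sum>\<^sub>s x\<^sub>s \<otimes> y\<^sub>s\<close>.  The minimal norm is the supremum of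
  \<open>\<parallel>(\<phi> \<otimes> \<psi>)(t)\<parallel>\<close> in \<open>M\<^sub>p \<otimes> M\<^sub>q\<close> over complete contractions \<open>\<phi> : X \<rightarrow> M\<^sub>p\<close> and \<open>\<psi> : Y \<rightarrow> M\<^sub>q\<close>; it
  depends only on the tensor represented by the list.
\<close>

definition min_norm :: "'x::plus operator_space \<Rightarrow> 'y::plus operator_space \<Rightarrow> ('x \<times> 'y) list \<Rightarrow> ereal" where
  "min_norm X Y t =
     Sup {ereal (op_norm ({..<p} \<times> {..<q})
            (\<lambda>(i, k) (j, l). \<Sum>(x, y)\<leftarrow>t. \<phi> x i j * \<psi> y k l)) | p q \<phi> \<psi>.
          \<phi> \<in> complete_contractions X p \<and> \<psi> \<in> complete_contractions Y q}"

text \<open>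
  The norm of \<open>id \<otimes> T : \<ell>\<^sub>1 \<otimes>\<^bsub>min\<^esub> X \<rightarrow> \<ell>\<^sub>1(Y)\<close>, for a normed space \<open>Y\<close> with the given scalar
  multiplication and norm.  By density the supremum is over the unit ball of the algebraic
  tensor product; \<open>id \<otimes> T\<close> maps \<open>\<Sum>\<^sub>s a\<^sub>s \<otimes> x\<^sub>s\<close> to the sequence \<open>k \<mapsto> \<Sum>\<^sub>s a\<^sub>s(k) T(x\<^sub>s)\<close>.
\<close>

definition pi_1cb ::
    "'x::plus operator_space \<Rightarrow> (complex \<Rightarrow> 'y::comm_monoid_add \<Rightarrow> 'y) \<Rightarrow> ('y \<Rightarrow> real) \<Rightarrow> ('x \<Rightarrow> 'y) \<Rightarrow> ereal" where
  "pi_1cb X scaleY normY T =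
     Sup {(\<Sum>k. ereal (normY (\<Sum>(a, x)\<leftarrow>t. scaleY (a k) (T x)))) | t.
          set t \<subseteq> os_carrier l1_space \<times> os_carrier X \<and> min_norm l1_space X t \<le> 1}"


subsection \<open>Quantum XOR games\<close>

definition game_map ::
    "complex^('n::finite \<times> 'm::finite)^('n \<times> 'm) \<Rightarrow> complex^'n^'n \<Rightarrow> complex^'m^'m" where
  "game_map G x = partial_trace (G ** tensor_mat (transpose x) (mat 1))"

text \<open>The trace below is real, since \<open>A\<^sub>k\<close>, \<open>B\<^sub>k\<close> and \<open>G\<close> are selfadjoint.\<close>

definition beta_owc :: "complex^('n::finite \<times> 'm::finite)^('n \<times> 'm) \<Rightarrow> ereal" where
  "beta_owc G =
     Sup {ereal (\<Sum>k=1..2^c. Re (trace (tensor_mat (E 1 k - E (-1) k) (F 1 k - F (-1) k) ** G))) |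
          (c :: nat) (E :: int \<Rightarrow> nat \<Rightarrow> complex^'n^'n) (F :: int \<Rightarrow> nat \<Rightarrow> complex^'m^'m).
          (\<forall>a\<in>{1, -1}. \<forall>k\<in>{1..2^c}. psd (E a k)) \<and>
          (\<Sum>a\<in>{1, -1}. \<Sum>k=1..2^c. E a k) = mat 1 \<and>
          (\<forall>b\<in>{1, -1}. \<forall>k\<in>{1..2^c}. psd (F b k)) \<and>
          (\<forall>k\<in>{1..2^c}. (\<Sum>b\<in>{1, -1}. F b k) = mat 1)}"

end

theory Submission
  imports Defs
begin

text \<open>
  An element of \<open>\<ell>\<^sub>1 \<otimes> S\<^sub>\<infinity>\<close> is a sequence \<open>X\<close> of matrices, and its minimal norm is at most 1 iff
  \<open>\<parallel>\<Sum>\<^sub>k C\<^sub>k \<otimes> X\<^sub>k\<parallel> \<le> 1\<close> for all families of contractions \<open>C\<^sub>k\<close>.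

  Lower bound: if the \<open>E\<^sub>a\<^sub>,\<^sub>k\<close> form a measurement, \<open>X\<^sub>k = (E\<^sub>1\<^sub>,\<^sub>k - E\<^sub>-\<^sub>1\<^sub>,\<^sub>k)\<^sup>T\<close> lies in the unit ball by
  Cauchy-Schwarz, and \<open>F\<^sub>1\<^sub>,\<^sub>k - F\<^sub>-\<^sub>1\<^sub>,\<^sub>k\<close> is a contraction, which is bounded by the trace norm.

  Upper bound: by polar decomposition the trace norms of the \<open>G(X\<^sub>k)\<close> are pairings with contractions,
  whose real and imaginary parts give two pairings \<open>\<Sum>\<^sub>k tr (X\<^sub>k\<^sup>T H\<^sub>k)\<close> with selfadjoint \<open>H\<^sub>k\<close> such
  that \<open>\<Sum>\<^sub>k tr ((E\<^sub>1\<^sub>,\<^sub>k - E\<^sub>-\<^sub>1\<^sub>,\<^sub>k) H\<^sub>k) \<le> \<beta>\<close> for all measurements.  Semidefinite duality gives \<open>Z\<close> with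
  \<open>-Z \<le> H\<^sub>k \<le> Z\<close> and \<open>tr Z \<le> \<beta>\<close>.  Writing \<open>H\<^sub>k = D\<^sup>* C\<^sub>k D\<close> with \<open>D\<^sup>* D = Z\<close> and contractions \<open>C\<^sub>k\<close>, the
  pairing is a value of the quadratic form of \<open>\<Sum>\<^sub>k C\<^sub>k \<otimes> X\<^sub>k\<close> at a vector of squared norm \<open>tr Z\<close>, so it
  is at most \<open>\<beta>\<close>.  This argument avoids Wittstock's decomposition theorem and yields the
  constant 2.
\<close>


subsection \<open>The spectral theorem\<close>

text \<open>Conjugate-linear in the first argument. Its real part is the inner product of the type
  class, so facts about real Euclidean spaces carry over.\<close>

definition cdot :: "complex^'n \<Rightarrow> complex^'n \<Rightarrow> complex" where
  "cdot u v = (\<Sum>i\<in>UNIV. cnj (u $ i) * v $ i)"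

lemma cdot_add_right: "cdot u (v + w) = cdot u v + cdot u w"
  by (simp add: cdot_def algebra_simps sum.distrib)

lemma cdot_add_left: "cdot (u + v) w = cdot u w + cdot v w"
  by (simp add: cdot_def algebra_simps sum.distrib)

lemma cdot_diff_right: "cdot u (v - w) = cdot u v - cdot u w"
  by (simp add: cdot_def algebra_simps sum_subtractf)

lemma cdot_diff_left: "cdot (u - v) w = cdot u w - cdot v w"
  by (simp add: cdot_def algebra_simps sum_subtractf)

lemma cdot_scaleR_right: "cdot u (r *\<^sub>R v) = of_real r * cdot u v"
  unfolding cdot_def sum_distrib_left
  by (rule sum.cong) (simp_all add: scaleR_conv_of_real [where 'a = complex])

lemma cdot_scaleR_left: "cdot (r *\<^sub>R u) v = of_real r * cdot u v"
  unfolding cdot_def sum_distrib_left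
  by (rule sum.cong) (simp_all add: scaleR_conv_of_real [where 'a = complex])

lemma matrix_vector_mult_scaleR_right: "A *v (r *\<^sub>R v) = r *\<^sub>R (A *v v)"
  for A :: "complex^'n^'m"
  by (simp add: matrix_vector_mult_def vec_eq_iff scaleR_sum_right)

lemma cnj_cdot: "cnj (cdot u v) = cdot v u"
  by (simp add: cdot_def mult.commute)

lemma inner_eq_Re_cdot: "inner u v = Re (cdot u v)" for u v :: "complex^'n"
  by (simp add: inner_vec_def cdot_def inner_complex_def)

lemma cdot_self: "cdot v v = of_real ((norm v)\<^sup>2)"
proof -
  have "Im (cdot v v) = 0"
    by (simp add: cdot_def mult.commute)
  then show ?thesis
    by (simp add: complex_eq_iff power2_norm_eq_inner inner_eq_Re_cdot)
qed

lemma cdot_matrix: "cdot u (A *v v) = cdot (adjoint_mat A *v u) v"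
  unfolding cdot_def matrix_vector_mult_def adjoint_mat_def
  apply (simp add: sum_distrib_left sum_distrib_right)
  apply (subst sum.swap)
  apply (simp add: mult_ac)
  done

lemma psd_iff_cdot: "psd A \<longleftrightarrow> selfadjoint A \<and> (\<forall>v. 0 \<le> Re (cdot v (A *v v)))"
  unfolding psd_def cdot_def matrix_vector_mult_def
  by (simp add: sum_distrib_left mult.assoc)

lemma adjoint_mat_mult: "adjoint_mat (A ** B) = adjoint_mat B ** adjoint_mat A"
  by (simp add: adjoint_mat_def matrix_matrix_mult_def vec_eq_iff mult.commute)

lemma adjoint_mat_adjoint [simp]: "adjoint_mat (adjoint_mat A) = A"
  by (simp add: adjoint_mat_def vec_eq_iff)

lemma adjoint_mat_add: "adjoint_mat (A + B) = adjoint_mat A + adjoint_mat B"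
  by (simp add: adjoint_mat_def vec_eq_iff)

lemma adjoint_mat_diff: "adjoint_mat (A - B) = adjoint_mat A - adjoint_mat B"
  by (simp add: adjoint_mat_def vec_eq_iff)

lemma adjoint_mat_minus: "adjoint_mat (- A) = - adjoint_mat A"
  by (simp add: adjoint_mat_def vec_eq_iff)

lemma adjoint_mat_scaleR: "adjoint_mat (r *\<^sub>R A) = r *\<^sub>R adjoint_mat A"
  by (simp add: adjoint_mat_def vec_eq_iff)

lemma adjoint_mat_zero [simp]: "adjoint_mat 0 = 0"
  by (simp add: adjoint_mat_def vec_eq_iff)

lemma adjoint_mat_sum: "adjoint_mat (\<Sum>j\<in>J. E j) = (\<Sum>j\<in>J. adjoint_mat (E j))"
  by (simp add: adjoint_mat_def vec_eq_iff)

lemma adjoint_mat_one [simp]: "adjoint_mat (mat 1) = mat 1"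
  by (simp add: adjoint_mat_def mat_def vec_eq_iff)

section \<open>Real diagonal matrices\<close>

definition rdiag :: "('n \<Rightarrow> real) \<Rightarrow> complex^'n^'n" where
  "rdiag d = (\<chi> i j. if i = j then of_real (d i) else 0)"

lemma rdiag_mult: "rdiag d ** rdiag e = rdiag (\<lambda>i. d i * e i)"
  by (auto simp: rdiag_def matrix_matrix_mult_def vec_eq_iff if_distrib [of "\<lambda>x. x * _"] cong: if_cong)

lemma adjoint_rdiag [simp]: "adjoint_mat (rdiag d) = rdiag d"
  by (auto simp: rdiag_def adjoint_mat_def vec_eq_iff)

lemma mult_rdiag_nth: "(A ** rdiag d) $ i $ j = A $ i $ j * of_real (d j)"
  by (auto simp: rdiag_def matrix_matrix_mult_def if_distrib cong: if_cong)

lemma rdiag_mult_nth: "(rdiag d ** A) $ i $ j = of_real (d i) * A $ i $ j"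
  by (auto simp: rdiag_def matrix_matrix_mult_def if_distrib [of "\<lambda>x. x * _"] cong: if_cong)

lemma matrix_mult_nth_cdot: "(adjoint_mat A ** B) $ i $ j = cdot (column i A) (column j B)"
  by (simp add: matrix_matrix_mult_def adjoint_mat_def cdot_def column_def)

text \<open>Real orthogonality to \<open>s\<close> and to \<open>\<i> * s\<close> kills the real and
  the imaginary part of \<open>cdot s v\<close>. Doubling \<open>S\<close> in this way stays below
  the real dimension \<open>2 * CARD('n)\<close>.\<close>

lemma exists_orthogonal_vector:
  fixes S :: "(complex^'n) set"
  assumes "finite S" "card S < CARD('n)"
  shows "\<exists>v. v \<noteq> 0 \<and> (\<forall>s\<in>S. cdot s v = 0)"
proof -
  define R where "R = S \<union> (\<lambda>s. \<chi> i. \<i> * s $ i) ` S"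
  have "dim (span R) \<le> card R"
    using assms(1) by (simp add: R_def dim_le_card')
  also have "\<dots> \<le> card S + card S"
    unfolding R_def using card_Un_le card_image_le[OF assms(1)] by (meson add_left_mono le_trans)
  also have "\<dots> < DIM(complex^'n)"
    using assms(2) by simp
  finally obtain v where v: "v \<noteq> 0" "\<And>y. y \<in> span R \<Longrightarrow> orthogonal v y"
    using orthogonal_to_subspace_exists[of R] by auto
  have "cdot s v = 0" if "s \<in> S" for s
  proof -
    have "orthogonal v s" "orthogonal v (\<chi> i. \<i> * s $ i)"
      using that by (auto intro!: v(2) span_base simp: R_def)
    then have "Re (cdot s v) = 0" "Re (cdot (\<chi> i. \<i> * s $ i) v) = 0"
      by (simp_all add: orthogonal_def inner_commute inner_eq_Re_cdot [symmetric])
    moreover have "cdot (\<chi> i. \<i> * s $ i) v = - \<i> * cdot s v"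
      by (simp add: cdot_def sum_distrib_left mult.assoc)
    ultimately show ?thesis
      by (simp add: complex_eq_iff)
  qed
  with v(1) show ?thesis by blast
qed

lemma continuous_on_cdot_matrix: "continuous_on S (\<lambda>v. Re (cdot v (A *v v)))"
  unfolding cdot_def matrix_vector_mult_def
  by (simp, intro continuous_intros)

text \<open>The quadratic form \<open>\<lambda>|v|\<^sup>2 - \<langle>v, A v\<rangle>\<close> is nonnegative on the complement of the eigenvectors
  found so far and vanishes at a maximiser \<open>v\<close> of the Rayleigh quotient; perturbing \<open>v\<close> in the
  direction \<open>\<lambda>v - A v\<close> shows that this direction is zero.\<close>

lemma exists_orthogonal_eigenvector:
  fixes A :: "complex^'n^'n"
  assumes "selfadjoint A" "finite S" "card S < CARD('n)"
    and eig: "\<And>s. s \<in> S \<Longrightarrow> \<exists>l::real. A *v s = l *\<^sub>R s"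
  shows "\<exists>v. norm v = 1 \<and> (\<forall>s\<in>S. cdot s v = 0) \<and> (\<exists>l::real. A *v v = l *\<^sub>R v)"
proof -
  define W where "W = {v. \<forall>s\<in>S. cdot s v = 0}"
  define K where "K = sphere 0 1 \<inter> W"
  define q where "q v = Re (cdot v (A *v v))" for v
  have adj: "adjoint_mat A = A"
    using assms(1) by (simp add: selfadjoint_def)
  obtain v0 where v0: "v0 \<noteq> 0" "v0 \<in> W"
    using exists_orthogonal_vector[OF assms(2,3)] by (auto simp: W_def)
  have scale: "r *\<^sub>R v \<in> W" if "v \<in> W" for r v
    using that by (simp add: W_def cdot_scaleR_right)
  have "W = (\<Inter>s\<in>S. {v. cdot s v = 0})"
    by (auto simp: W_def)
  moreover have "closed {v. cdot s v = 0}" for s :: "complex^'n"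
    unfolding cdot_def by (intro closed_Collect_eq continuous_intros)
  ultimately have "closed W"
    by auto
  then have "compact K"
    unfolding K_def by (intro compact_Int_closed) auto
  moreover have "(1 / norm v0) *\<^sub>R v0 \<in> K"
    using v0 scale by (auto simp: K_def)
  ultimately obtain v where v: "v \<in> K" and max: "\<And>w. w \<in> K \<Longrightarrow> q w \<le> q v"
    using continuous_attains_sup[of K q] continuous_on_cdot_matrix[of K A]
    unfolding q_def by blast
  define l where "l = q v"
  define w where "w = l *\<^sub>R v - A *v v"
  have nv: "norm v = 1" and vW: "v \<in> W"
    using v by (auto simp: K_def)
  have nonneg: "0 \<le> l * (norm u)\<^sup>2 - q u" if "u \<in> W" for u
  proof (cases "u = 0")
    case False
    then have "(1 / norm u) *\<^sub>R u \<in> K"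
      using that scale by (auto simp: K_def)
    from max[OF this] have "q u / (norm u)\<^sup>2 \<le> l"
      by (simp add: q_def l_def matrix_vector_mult_scaleR_right cdot_scaleR_right cdot_scaleR_left
          power2_eq_square divide_simps mult_ac)
    then show ?thesis
      using False by (simp add: divide_simps)
  qed (simp add: q_def cdot_def)
  \<comment> \<open>The complement is invariant because \<open>S\<close> consists of eigenvectors of
    the selfadjoint \<open>A\<close>; hence the direction \<open>w\<close> stays inside
    \<open>W\<close>.\<close>
  have "A *v v \<in> W"
    unfolding W_def
  proof safe
    fix s assume s: "s \<in> S"
    obtain r :: real where "A *v s = r *\<^sub>R s"
      using eig[OF s] by blast
    then show "cdot s (A *v v) = 0"
      using s vW by (simp add: cdot_matrix adj cdot_scaleR_left W_def)
  qed
  then have wW: "w \<in> W"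
    using vW by (simp add: w_def W_def cdot_diff_right cdot_scaleR_right)
  define c where "c = l * (norm w)\<^sup>2 - q w"
  \<comment> \<open>The form at \<open>v + t *\<^sub>R w\<close> has constant term 0, since it
    vanishes at \<open>v\<close>, and its linear coefficient is twice the squared norm of
    \<open>w\<close> by the choice of \<open>w\<close>.\<close>
  have quad: "0 \<le> 2 * t * (norm w)\<^sup>2 + t\<^sup>2 * c" for t
  proof -
    have "v + t *\<^sub>R w \<in> W"
      using wW vW by (simp add: W_def cdot_add_right cdot_scaleR_right)
    note nonneg[OF this]
    moreover have "(norm (v + t *\<^sub>R w))\<^sup>2 = (norm v)\<^sup>2 + 2 * t * inner w v + t\<^sup>2 * (norm w)\<^sup>2"
      by (simp add: power2_norm_eq_inner inner_add_left inner_add_right inner_commute [of v w])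
        (simp add: power2_eq_square algebra_simps)
    moreover have "q (v + t *\<^sub>R w) = q v + 2 * t * Re (cdot w (A *v v)) + t\<^sup>2 * q w"
    proof -
      have "Re (cdot v (A *v w)) = Re (cdot w (A *v v))"
        by (metis adj cdot_matrix inner_commute inner_eq_Re_cdot)
      then show ?thesis
        by (simp add: q_def matrix_vector_mult_scaleR_right cdot_scaleR_right cdot_scaleR_left
          matrix_vector_right_distrib cdot_add_left cdot_add_right power2_eq_square algebra_simps)
    qed
    moreover have "(norm w)\<^sup>2 = l * inner w v - Re (cdot w (A *v v))"
    proof -
      have "(norm w)\<^sup>2 = inner w (l *\<^sub>R v - A *v v)"
        by (simp add: power2_norm_eq_inner w_def)
      also have "\<dots> = l * inner w v - Re (cdot w (A *v v))"
        by (simp add: inner_eq_Re_cdot cdot_diff_right cdot_scaleR_right)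
      finally show ?thesis .
    qed
    ultimately have "0 \<le> l * (1 + 2 * t * inner w v + t\<^sup>2 * (norm w)\<^sup>2)
        - (l + 2 * t * (l * inner w v - (norm w)\<^sup>2) + t\<^sup>2 * q w)"
      using nv by (simp add: l_def)
    then show ?thesis
      by (simp add: c_def algebra_simps)
  qed
  have "norm w = 0"
  proof (rule ccontr)
    assume "norm w \<noteq> 0"
    then have pos: "(norm w)\<^sup>2 > 0" by simp
    \<comment> \<open>For this negative \<open>t\<close> the modulus of \<open>t * c\<close> is
      below the squared norm of \<open>w\<close>, so the linear term prevails and the quadratic is
      negative.\<close>
    define t where "t = - (norm w)\<^sup>2 / (\<bar>c\<bar> + 1)"
    have cpos: "\<bar>c\<bar> + 1 > 0"
      by linarith
    have "t < 0"
      using pos cpos by (simp add: t_def)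
    moreover have "- t * (\<bar>c\<bar> + 1) = (norm w)\<^sup>2"
      using cpos by (simp add: t_def)
    moreover have "t * c \<ge> - (- t * \<bar>c\<bar>)"
      using \<open>t < 0\<close> by (cases "c \<ge> 0") (auto simp: mult_nonpos_nonpos)
    moreover have "- t * (\<bar>c\<bar> + 1) = - t * \<bar>c\<bar> - t"
      by (simp add: algebra_simps)
    ultimately have "2 * (norm w)\<^sup>2 + t * c > 0"
      using pos by linarith
    then have "t * (2 * (norm w)\<^sup>2 + t * c) < 0"
      using \<open>t < 0\<close> by (simp add: mult_neg_pos)
    then show False
      using quad[of t] by (simp add: power2_eq_square algebra_simps)
  qed
  then have "A *v v = l *\<^sub>R v"
    by (simp add: w_def)
  with nv vW show ?thesis
    unfolding W_def by blast
qed

lemma exists_orthonormal_eigenvectors: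
  fixes A :: "complex^'n^'n"
  assumes "selfadjoint A" "k \<le> CARD('n)"
  shows "\<exists>S. finite S \<and> card S = k \<and> (\<forall>s\<in>S. \<exists>l::real. A *v s = l *\<^sub>R s) \<and>
    (\<forall>s\<in>S. \<forall>t\<in>S. cdot s t = (if s = t then 1 else 0))"
  using assms(2)
proof (induction k)
  case 0
  show ?case by (rule exI[of _ "{}"]) simp
next
  case (Suc k)
  then obtain S where S: "finite S" "card S = k" "\<forall>s\<in>S. \<exists>l::real. A *v s = l *\<^sub>R s"
    "\<forall>s\<in>S. \<forall>t\<in>S. cdot s t = (if s = t then 1 else 0)" by auto
  with Suc.prems obtain v where v: "norm v = 1" "\<forall>s\<in>S. cdot s v = 0" "\<exists>l::real. A *v v = l *\<^sub>R v"
    using exists_orthogonal_eigenvector[OF assms(1), of S] by auto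
  have vv: "cdot v v = 1" using v(1) by (simp add: cdot_self)
  have "v \<notin> S" using v(2) vv by auto
  moreover have "\<forall>s\<in>S. cdot v s = 0" using v(2) by (metis cnj_cdot complex_cnj_zero)
  ultimately show ?case
    using S v vv by (intro exI[of _ "insert v S"]) auto
qed

text \<open>The columns of \<open>V\<close> are a full orthonormal set of eigenvectors, which gives
  \<open>A ** V = V ** rdiag d\<close>; unitarity moves \<open>V\<close> to the other side.\<close>

theorem spectral_theorem:
  fixes A :: "complex^'n^'n"
  assumes "selfadjoint A"
  obtains V :: "complex^'n^'n" and d where "adjoint_mat V ** V = mat 1" "V ** adjoint_mat V = mat 1"
    "A = V ** rdiag d ** adjoint_mat V"
proof -
  obtain S where S: "finite S" "card S = CARD('n)" "\<forall>s\<in>S. \<exists>l::real. A *v s = l *\<^sub>R s"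
    "\<forall>s\<in>S. \<forall>t\<in>S. cdot s t = (if s = t then 1 else 0)"
    using exists_orthonormal_eigenvectors[OF assms order_refl] by blast
  obtain h :: "'n \<Rightarrow> complex^'n" where h: "bij_betw h UNIV S"
    using finite_same_card_bij[of "UNIV :: 'n set" S] S by auto
  have hS: "h i \<in> S" for i using h by (auto simp: bij_betw_def)
  have hinj: "h i = h j \<longleftrightarrow> i = j" for i j using h by (auto simp: bij_betw_def inj_on_def)
  define d where "d i = (SOME l::real. A *v h i = l *\<^sub>R h i)" for i
  have d: "A *v h i = d i *\<^sub>R h i" for i
  proof -
    have "\<exists>l::real. A *v h i = l *\<^sub>R h i"
      using S(3) hS[of i] by blast
    from someI_ex[OF this] show ?thesis
      by (simp only: d_def)
  qed
  define V :: "complex^'n^'n" where "V = (\<chi> i j. h j $ i)"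
  have col: "column j V = h j" for j by (simp add: column_def V_def vec_eq_iff)
  have 1: "adjoint_mat V ** V = mat 1"
    using S(4) hS hinj by (auto simp: vec_eq_iff matrix_mult_nth_cdot col mat_def)
  then have 2: "V ** adjoint_mat V = mat 1"
    by (simp add: matrix_left_right_inverse)
  have "A ** V = V ** rdiag d"
  proof -
    have "(A ** V) $ i $ j = (A *v h j) $ i" for i j
      by (simp add: matrix_matrix_mult_def matrix_vector_mult_def V_def)
    then show ?thesis
      by (simp add: vec_eq_iff mult_rdiag_nth d V_def scaleR_conv_of_real [where 'a = complex])
  qed
  then have "A = V ** rdiag d ** adjoint_mat V"
    by (metis 2 matrix_mul_assoc matrix_mul_rid)
  then show ?thesis by (rule that[OF 1 2])
qed


subsection \<open>Square roots, polar decomposition and the trace norm\<close>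

lemma cdot_axis: "cdot (axis i 1) v = v $ i"
proof -
  have "cdot (axis i 1) v = (\<Sum>j\<in>UNIV. if j = i then v $ j else 0)"
    unfolding cdot_def axis_def by (rule sum.cong) auto
  then show ?thesis by simp
qed

lemma matrix_vector_mult_axis: "(A *v axis j 1) $ i = A $ i $ j"
  for A :: "complex^'n^'m"
proof -
  have "(A *v axis j 1) $ i = (\<Sum>k\<in>UNIV. if k = j then A $ i $ k else 0)"
    unfolding matrix_vector_mult_def axis_def by (simp only: vec_lambda_beta, rule sum.cong) auto
  then show ?thesis by simp
qed

lemma norm_cdot_le: "cmod (cdot u v) \<le> norm u * norm v"
proof -
  have "cmod (cdot u v) \<le> (\<Sum>i\<in>UNIV. \<bar>cmod (u $ i)\<bar> * \<bar>cmod (v $ i)\<bar>)"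
    unfolding cdot_def by (rule order_trans[OF norm_sum]) (simp add: norm_mult)
  also have "\<dots> \<le> norm u * norm v"
    unfolding norm_vec_def by (rule L2_set_mult_ineq)
  finally show ?thesis .
qed

section \<open>Positive matrices\<close>

lemma psd_conjugate:
  assumes "psd A"
  shows "psd (adjoint_mat B ** A ** B)"
proof -
  have "cdot v ((adjoint_mat B ** A ** B) *v v) = cdot (B *v v) (A *v (B *v v))" for v
    using cdot_matrix[of v "adjoint_mat B" "A *v (B *v v)"]
    by (simp add: matrix_vector_mul_assoc matrix_mul_assoc)
  then show ?thesis
    using assms by (simp add: psd_iff_cdot selfadjoint_def adjoint_mat_mult matrix_mul_assoc)
qed

lemma psd_diag_nonneg:
  assumes "psd A"
  shows "0 \<le> Re (A $ i $ i)"
proof -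
  have "A $ i $ i = cdot (axis i 1) (A *v axis i 1)"
    by (simp add: cdot_axis matrix_vector_mult_axis)
  then show ?thesis
    using assms by (simp add: psd_iff_cdot)
qed

lemma selfadjoint_nth: "selfadjoint A \<Longrightarrow> cnj (A $ i $ j) = A $ j $ i"
proof -
  assume "selfadjoint A"
  then have "adjoint_mat A $ j $ i = A $ j $ i"
    by (simp add: selfadjoint_def)
  then show ?thesis
    by (simp add: adjoint_mat_def)
qed

lemma psd_one: "psd (mat 1)"
  by (simp add: psd_iff_cdot selfadjoint_def cdot_self)

lemma psd_adjoint_mult: "psd (adjoint_mat B ** B)"
  using psd_conjugate[OF psd_one, of B] by simp

lemma psd_rdiag: "(\<And>i. 0 \<le> d i) \<Longrightarrow> psd (rdiag d)"
  using psd_adjoint_mult[of "rdiag (\<lambda>i. sqrt (d i))"] by (simp add: rdiag_mult)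

lemma psd_add: "psd A \<Longrightarrow> psd B \<Longrightarrow> psd (A + B)"
  by (simp add: psd_iff_cdot selfadjoint_def adjoint_mat_add cdot_add_right
      matrix_vector_mult_add_rdistrib)

lemma psd_zero: "psd 0"
  by (simp add: psd_def selfadjoint_def)

lemma matrix_vector_mult_scaleR_left: "(r *\<^sub>R A) *v v = r *\<^sub>R (A *v v)"
  for A :: "complex^'n^'m"
  by (simp add: matrix_vector_mult_def vec_eq_iff scaleR_sum_right)

lemma psd_scaleR: "0 \<le> r \<Longrightarrow> psd A \<Longrightarrow> psd (r *\<^sub>R A)"
  by (simp add: psd_iff_cdot selfadjoint_def adjoint_mat_scaleR cdot_scaleR_right
      matrix_vector_mult_scaleR_left)

lemma unitary_conjugate_cancel:
  fixes V :: "complex^'n^'n"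
  assumes "adjoint_mat V ** V = mat 1"
  shows "(V ** A ** adjoint_mat V) ** (V ** B ** adjoint_mat V) = V ** (A ** B) ** adjoint_mat V"
proof -
  have "(V ** A ** adjoint_mat V) ** (V ** B ** adjoint_mat V)
    = V ** A ** (adjoint_mat V ** V) ** B ** adjoint_mat V"
    by (simp only: matrix_mul_assoc)
  then show ?thesis
    by (simp add: assms matrix_mul_assoc)
qed

lemma psd_spectral:
  fixes A :: "complex^'n^'n"
  assumes "psd A"
  obtains V :: "complex^'n^'n" and d where "adjoint_mat V ** V = mat 1" "V ** adjoint_mat V = mat 1"
    "A = V ** rdiag d ** adjoint_mat V" "\<And>i. 0 \<le> d i"
proof -
  have "selfadjoint A"
    using assms by (simp add: psd_def)
  then obtain V :: "complex^'n^'n" and d where V: "adjoint_mat V ** V = mat 1" "V ** adjoint_mat V = mat 1"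
    "A = V ** rdiag d ** adjoint_mat V"
    by (rule spectral_theorem)
  have "adjoint_mat V ** A ** V = (adjoint_mat V ** V) ** rdiag d ** (adjoint_mat V ** V)"
    unfolding V(3) by (simp only: matrix_mul_assoc)
  then have "adjoint_mat V ** A ** V = rdiag d"
    by (simp add: V(1))
  then have "psd (rdiag d)"
    using psd_conjugate[OF assms, of V] by simp
  then have "0 \<le> d i" for i
    using psd_diag_nonneg[of "rdiag d" i] by (simp add: rdiag_def)
  then show ?thesis
    by (rule that[OF V])
qed

lemma matrix_add_rdistrib: "(A + B) ** C = A ** C + B ** C"
  for A :: "complex^'n^'m"
  by (simp add: matrix_matrix_mult_def vec_eq_iff distrib_right sum.distrib)

lemma matrix_sub_ldistrib: "A ** (B - C) = A ** B - A ** C"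
  for A :: "complex^'n^'m"
  by (simp add: matrix_matrix_mult_def vec_eq_iff right_diff_distrib sum_subtractf)

lemma matrix_sub_rdistrib: "(A - B) ** C = A ** C - B ** C"
  for A :: "complex^'n^'m"
  by (simp add: matrix_matrix_mult_def vec_eq_iff left_diff_distrib sum_subtractf)

text \<open>Diagonalise \<open>P - Q\<close>. Since \<open>P ** (P - Q) + (P - Q) ** Q = 0\<close>,
  the diagonal entries in the eigenbasis satisfy \<open>d i * (P' $ i $ i + Q' $ i $ i) = 0\<close>.
  Both entries are nonnegative and their difference is \<open>d i\<close>, so
  \<open>d i = 0\<close>. This justifies the definite description in \<open>abs_mat\<close>.\<close>

lemma psd_square_unique:
  fixes P :: "complex^'n^'n"
  assumes "psd P" "psd Q" "P ** P = Q ** Q"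
  shows "P = Q"
proof -
  have "selfadjoint (P - Q)"
    using assms by (simp add: psd_def selfadjoint_def adjoint_mat_diff)
  then obtain V :: "complex^'n^'n" and d where V: "adjoint_mat V ** V = mat 1" "V ** adjoint_mat V = mat 1"
    "P - Q = V ** rdiag d ** adjoint_mat V"
    by (rule spectral_theorem)
  define P' Q' where "P' = adjoint_mat V ** P ** V" and "Q' = adjoint_mat V ** Q ** V"
  have "adjoint_mat V ** (P - Q) ** V = (adjoint_mat V ** V) ** rdiag d ** (adjoint_mat V ** V)"
    unfolding V(3) by (simp only: matrix_mul_assoc)
  then have diff: "P' - Q' = rdiag d"
    by (simp add: V(1) P'_def Q'_def matrix_sub_ldistrib matrix_sub_rdistrib)
  have "P' ** P' = adjoint_mat V ** (P ** (V ** adjoint_mat V) ** P) ** V"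
    "Q' ** Q' = adjoint_mat V ** (Q ** (V ** adjoint_mat V) ** Q) ** V"
    unfolding P'_def Q'_def by (simp_all only: matrix_mul_assoc)
  then have "P' ** P' = Q' ** Q'"
    by (simp add: V(2) assms(3))
  then have "P' ** (P' - Q') + (P' - Q') ** Q' = 0"
    by (simp add: matrix_sub_ldistrib matrix_sub_rdistrib)
  then have sum0: "P' ** rdiag d + rdiag d ** Q' = 0"
    by (simp add: diff)
  have "d i = 0" for i
  proof -
    have "(P' ** rdiag d + rdiag d ** Q') $ i $ i = 0"
      by (simp add: sum0)
    then have "of_real (d i) * (P' $ i $ i + Q' $ i $ i) = 0"
      by (simp only: vector_add_component mult_rdiag_nth rdiag_mult_nth) (simp add: algebra_simps)
    moreover have "0 \<le> Re (P' $ i $ i)" "0 \<le> Re (Q' $ i $ i)"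
      using psd_conjugate assms(1,2) psd_diag_nonneg unfolding P'_def Q'_def by blast+
    moreover have "Re (P' $ i $ i) - Re (Q' $ i $ i) = d i"
    proof -
      have "(P' - Q') $ i $ i = of_real (d i)"
        unfolding diff by (simp add: rdiag_def)
      then have "Re ((P' - Q') $ i $ i) = d i"
        by simp
      then show ?thesis
        by (simp only: vector_minus_component minus_complex.simps)
    qed
    ultimately show ?thesis
      by (auto simp: complex_eq_iff)
  qed
  then have "rdiag d = 0"
    by (simp add: rdiag_def vec_eq_iff)
  then show ?thesis
    using V(3) by simp
qed

text \<open>Makes the definite description concrete: the square root is taken on the eigenvalues of
  \<open>adjoint_mat A ** A\<close>.\<close>

lemma abs_mat_spectral:
  fixes A :: "complex^'n^'n"
  obtains V :: "complex^'n^'n" and d where "adjoint_mat V ** V = mat 1" "V ** adjoint_mat V = mat 1"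
    "abs_mat A = V ** rdiag d ** adjoint_mat V" "\<And>i. 0 \<le> d i"
    "adjoint_mat A ** A = V ** rdiag (\<lambda>i. d i * d i) ** adjoint_mat V"
proof -
  obtain V :: "complex^'n^'n" and e where V: "adjoint_mat V ** V = mat 1" "V ** adjoint_mat V = mat 1"
    "adjoint_mat A ** A = V ** rdiag e ** adjoint_mat V" and e: "\<And>i. 0 \<le> e i"
    by (rule psd_spectral[OF psd_adjoint_mult[of A]]) (rule that)
  define d where "d i = sqrt (e i)" for i
  define P where "P = V ** rdiag d ** adjoint_mat V"
  have d: "0 \<le> d i" "e = (\<lambda>i. d i * d i)" for i
    using e by (auto simp: d_def)
  have "psd P"
    using psd_conjugate[OF psd_rdiag[of d], of "adjoint_mat V"] d by (simp add: P_def)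
  moreover have "P ** P = adjoint_mat A ** A"
    by (simp add: P_def unitary_conjugate_cancel[OF V(1)] rdiag_mult V(3) d(2))
  ultimately have "abs_mat A = P"
    unfolding abs_mat_def by (intro the_equality) (auto intro: psd_square_unique)
  then show ?thesis
    using V d by (intro that[of V d]) (simp_all add: P_def)
qed

text \<open>Operator norm at most 1, stated without a supremum;
  \<open>contraction_iff_op_norm\<close> connects it with \<open>op_norm\<close>.\<close>

definition contraction :: "complex^'n^'n \<Rightarrow> bool" where
  "contraction W \<longleftrightarrow> (\<forall>v. norm (W *v v) \<le> norm v)"

lemma contraction_mult: "contraction A \<Longrightarrow> contraction B \<Longrightarrow> contraction (A ** B)"
  unfolding contraction_def matrix_vector_mul_assoc[symmetric] by (meson order_trans)

lemma contraction_adjoint: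
  assumes "contraction W"
  shows "contraction (adjoint_mat W)"
  unfolding contraction_def
proof
  fix v
  let ?w = "adjoint_mat W *v v"
  have "(norm ?w)\<^sup>2 = cmod (cdot ?w ?w)"
    by (simp add: cdot_self norm_power)
  also have "\<dots> = cmod (cdot v (W *v ?w))"
    by (simp add: cdot_matrix)
  also have "\<dots> \<le> norm v * norm (W *v ?w)"
    by (rule norm_cdot_le)
  also have "\<dots> \<le> norm v * norm ?w"
    using assms by (simp add: contraction_def mult_left_mono)
  finally show "norm ?w \<le> norm v"
    by (cases "norm ?w = 0") (auto simp: power2_eq_square)
qed

lemma contraction_unitary: "adjoint_mat V ** V = mat 1 \<Longrightarrow> contraction V"
  unfolding contraction_def
proof
  fix v assume "adjoint_mat V ** V = mat 1"
  then have "cdot (V *v v) (V *v v) = cdot v v"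
    by (simp add: cdot_matrix[of _ V] matrix_vector_mul_assoc)
  then have "(norm (V *v v))\<^sup>2 = (norm v)\<^sup>2"
    unfolding cdot_self of_real_eq_iff .
  then show "norm (V *v v) \<le> norm v" by simp
qed

lemma contraction_nth_le:
  assumes "contraction W"
  shows "cmod (W $ i $ j) \<le> 1"
proof -
  have "W $ i $ j = cdot (axis i 1) (W *v axis j 1)"
    by (simp add: cdot_axis matrix_vector_mult_axis)
  also have "cmod \<dots> \<le> norm (axis i 1 :: complex^'a) * norm (W *v axis j 1)"
    by (rule norm_cdot_le)
  also have "\<dots> \<le> 1"
    using assms norm_axis_1[of j] by (auto simp: contraction_def norm_axis_1 dest: spec[of _ "axis j 1"])
  finally show ?thesis .
qed

lemma contraction_rdiag:
  assumes "\<And>i. \<bar>d i\<bar> \<le> 1"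
  shows "contraction (rdiag d)"
  unfolding contraction_def
proof
  fix v
  have "(rdiag d *v v) $ i = of_real (d i) * v $ i" for i
    by (simp add: matrix_vector_mult_def rdiag_def if_distrib [of "\<lambda>x. x * _"] cong: if_cong)
  then show "norm (rdiag d *v v) \<le> norm v"
    using assms by (intro norm_le_componentwise_cart) (simp add: norm_mult mult_left_le_one_le)
qed

section \<open>Polar decomposition\<close>

lemma adjoint_mult_eq_0:
  assumes "adjoint_mat N ** N = 0"
  shows "N = 0"
proof -
  have "cdot (column j N) (column j N) = 0" for j
    using assms matrix_mult_nth_cdot[of N N j j] by simp
  then have "column j N = 0" for j
    by (simp add: cdot_self)
  then show ?thesis
    by (simp add: column_def vec_eq_iff)
qed

text \<open>\<open>W\<close> is the pseudo-inverse of \<open>abs_mat A\<close> times the adjoint of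
  \<open>A\<close>, that is, the adjoint of the usual partial isometry. It is a contraction because
  \<open>W ** adjoint_mat W\<close> is the projection onto the range of
  \<open>abs_mat A\<close>.\<close>

lemma polar_decomposition:
  fixes A :: "complex^'n^'n"
  obtains W where "contraction W" "W ** A = abs_mat A" "A = adjoint_mat W ** abs_mat A"
proof -
  obtain V :: "complex^'n^'n" and d where V: "adjoint_mat V ** V = mat 1" "V ** adjoint_mat V = mat 1"
    and P: "abs_mat A = V ** rdiag d ** adjoint_mat V" and d: "\<And>i. 0 \<le> d i"
    and AA: "adjoint_mat A ** A = V ** rdiag (\<lambda>i. d i * d i) ** adjoint_mat V"
    by (rule abs_mat_spectral[of A]) (rule that)
  define conj where "conj X = V ** X ** adjoint_mat V" for X
  define e where "e i = (if d i = 0 then 0 else 1 / d i)" for i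
  define p where "p i = (if d i = 0 then 0 else 1::real)" for i
  define W where "W = conj (rdiag e) ** adjoint_mat A"
  have conj_mult: "conj X ** conj Y = conj (X ** Y)" for X Y
    unfolding conj_def by (rule unitary_conjugate_cancel[OF V(1)])
  have conj_adj: "adjoint_mat (conj (rdiag f)) = conj (rdiag f)" for f
    by (simp add: conj_def adjoint_mat_mult matrix_mul_assoc)
  have adjW: "adjoint_mat W = A ** conj (rdiag e)"
    by (simp add: W_def adjoint_mat_mult conj_adj)
  have ede: "(\<lambda>i. e i * (d i * d i)) = d" "(\<lambda>i. e i * (d i * d i) * e i) = p" "(\<lambda>i. e i * d i) = p"
    "(\<lambda>i. d i * e i) = p"
    by (auto simp: e_def p_def)
  have "W ** A = conj (rdiag e) ** conj (rdiag (\<lambda>i. d i * d i))"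
    by (simp add: W_def AA[folded conj_def, symmetric] matrix_mul_assoc)
  then have WA: "W ** A = abs_mat A"
    by (simp add: P conj_mult rdiag_mult ede flip: conj_def)
  have "W ** adjoint_mat W = conj (rdiag e) ** (adjoint_mat A ** A) ** conj (rdiag e)"
    by (simp add: W_def adjW matrix_mul_assoc adjoint_mat_mult conj_adj)
  also have "\<dots> = conj (rdiag p)"
    by (simp only: AA[folded conj_def] conj_mult rdiag_mult ede)
  finally have WW: "W ** adjoint_mat W = conj (rdiag p)" .
  have contr_p: "contraction (conj (rdiag p))"
    unfolding conj_def using V
    by (intro contraction_mult contraction_unitary contraction_rdiag) (auto simp: p_def)
  have "contraction (adjoint_mat W)"
    unfolding contraction_def
  proof
    fix v
    let ?w = "adjoint_mat W *v v"
    have "cdot ?w ?w = cdot v ((W ** adjoint_mat W) *v v)"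
      by (simp add: cdot_matrix[of v W] flip: matrix_vector_mul_assoc)
    moreover have "(norm ?w)\<^sup>2 = cmod (cdot ?w ?w)"
      by (simp add: cdot_self norm_power)
    ultimately have "(norm ?w)\<^sup>2 = cmod (cdot v (conj (rdiag p) *v v))"
      by (simp only: WW)
    also have "\<dots> \<le> norm v * norm (conj (rdiag p) *v v)"
      by (rule norm_cdot_le)
    also have "\<dots> \<le> (norm v)\<^sup>2"
      using contr_p by (simp add: contraction_def power2_eq_square mult_left_mono)
    finally show "norm ?w \<le> norm v"
      by (rule power2_le_imp_le) simp
  qed
  then have contrW: "contraction W"
    using contraction_adjoint by fastforce
  \<comment> \<open>\<open>N\<close> is \<open>A\<close> cut down to the kernel of its absolute
    value. There \<open>adjoint_mat A ** A\<close> vanishes, hence so does \<open>A\<close>.\<close>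
  define N where "N = A ** conj (rdiag (\<lambda>i. 1 - p i))"
  have "adjoint_mat N ** N = conj (rdiag (\<lambda>i. 1 - p i)) ** (adjoint_mat A ** A) ** conj (rdiag (\<lambda>i. 1 - p i))"
    by (simp add: N_def adjoint_mat_mult conj_adj matrix_mul_assoc)
  also have "\<dots> = conj (rdiag (\<lambda>i. (1 - p i) * (d i * d i) * (1 - p i)))"
    by (simp only: AA[folded conj_def] conj_mult rdiag_mult)
  also have "(\<lambda>i. (1 - p i) * (d i * d i) * (1 - p i)) = (\<lambda>i. 0)"
    by (auto simp: p_def)
  also have "rdiag (\<lambda>i. 0) = 0"
    by (simp add: rdiag_def vec_eq_iff)
  also have "conj 0 = 0"
    by (simp add: conj_def)
  finally have "N = 0"
    by (rule adjoint_mult_eq_0)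
  have "adjoint_mat W ** abs_mat A = A ** conj (rdiag p)"
    by (simp only: adjW P[folded conj_def] conj_mult rdiag_mult ede flip: matrix_mul_assoc)
  then have "adjoint_mat W ** abs_mat A + N = A ** (conj (rdiag p) + conj (rdiag (\<lambda>i. 1 - p i)))"
    by (simp add: N_def matrix_add_ldistrib)
  also have "conj (rdiag p) + conj (rdiag (\<lambda>i. 1 - p i)) = conj (rdiag p + rdiag (\<lambda>i. 1 - p i))"
    by (simp add: conj_def matrix_add_ldistrib matrix_add_rdistrib)
  also have "rdiag p + rdiag (\<lambda>i. 1 - p i) = mat 1"
    by (simp add: rdiag_def vec_eq_iff mat_def)
  finally have "A = adjoint_mat W ** abs_mat A"
    by (simp add: \<open>N = 0\<close> conj_def V(2))
  with contrW WA show ?thesis by (rule that)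
qed

section \<open>Duality between the trace norm and the operator norm\<close>

lemma trace_norm_attained:
  obtains W where "contraction W" "trace_norm A = Re (trace (W ** A))"
proof -
  obtain W where "contraction W" "W ** A = abs_mat A" "A = adjoint_mat W ** abs_mat A"
    by (rule polar_decomposition)
  then show ?thesis
    by (intro that[of W]) (simp_all add: trace_norm_def)
qed

text \<open>In an eigenbasis of the absolute value the trace is the sum of the eigenvalues
  \<open>d i\<close> weighted by diagonal entries of a contraction \<open>M\<close>. These have
  modulus at most 1, and the \<open>d i\<close> add up to the trace norm.\<close>

lemma norm_trace_mult_le:
  fixes A :: "complex^'n^'n"
  assumes "contraction B"
  shows "cmod (trace (B ** A)) \<le> trace_norm A"
proof -
  obtain V :: "complex^'n^'n" and d where V: "adjoint_mat V ** V = mat 1" "V ** adjoint_mat V = mat 1"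
    and P: "abs_mat A = V ** rdiag d ** adjoint_mat V" and d: "\<And>i. 0 \<le> d i"
    by (rule abs_mat_spectral[of A]) (rule that)
  obtain W where W: "contraction W" "A = adjoint_mat W ** abs_mat A"
    by (rule polar_decomposition)
  define M where "M = adjoint_mat V ** (B ** adjoint_mat W) ** V"
  have "B ** A = B ** (adjoint_mat W ** (V ** rdiag d ** adjoint_mat V))"
    using W(2) P by simp
  then have "B ** A = (B ** adjoint_mat W ** V ** rdiag d) ** adjoint_mat V"
    by (simp add: matrix_mul_assoc)
  then have "trace (B ** A) = trace (M ** rdiag d)"
    unfolding M_def by (simp add: trace_mul_sym[of _ "adjoint_mat V"] matrix_mul_assoc)
  also have "\<dots> = (\<Sum>i\<in>UNIV. M $ i $ i * of_real (d i))"
    by (simp add: trace_def mult_rdiag_nth)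
  finally have tr: "trace (B ** A) = (\<Sum>i\<in>UNIV. M $ i $ i * of_real (d i))" .
  have "contraction M"
    unfolding M_def using assms W(1) contraction_unitary[OF V(1)]
    by (intro contraction_mult contraction_adjoint)
  then have "cmod (trace (B ** A)) \<le> (\<Sum>i\<in>UNIV. d i)"
    unfolding tr using contraction_nth_le[of M] d
    by (intro sum_norm_le) (simp add: norm_mult mult_left_le_one_le)
  also have "(\<Sum>i\<in>UNIV. d i) = trace_norm A"
  proof -
    have "trace (abs_mat A) = trace (rdiag d)"
      unfolding P by (simp add: trace_mul_sym[of _ "adjoint_mat V"] matrix_mul_assoc V(1))
    then show ?thesis
      by (simp add: trace_norm_def trace_def rdiag_def)
  qed
  finally show ?thesis .
qed

lemma trace_norm_nonneg: "0 \<le> trace_norm A"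
proof -
  have "contraction 0"
    by (simp add: contraction_def)
  from norm_trace_mult_le[OF this, of A] show ?thesis
    by (simp add: trace_def)
qed


subsection \<open>Operator norms\<close>

text \<open>A selfadjoint matrix is bounded in norm by its quadratic form: polarise at
  \<open>w = B *v v\<close> and apply the parallelogram law, so that 4 times the squared norm of
  \<open>w\<close> is at most twice the sum of the squared norms of \<open>w\<close> and
  \<open>v\<close>.\<close>

lemma psd_diff_abs_contraction:
  assumes "selfadjoint B" "psd (mat 1 - B)" "psd (mat 1 + B)"
  shows "contraction B"
  unfolding contraction_def
proof
  fix v
  define w where "w = B *v v"
  have bound: "\<bar>Re (cdot x (B *v x))\<bar> \<le> (norm x)\<^sup>2" for x
    using assms(2,3)
    by (auto simp: psd_iff_cdot matrix_vector_mult_add_rdistrib matrix_vector_mult_diff_rdistrib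
        cdot_add_right cdot_diff_right cdot_self abs_le_iff dest!: spec[of _ x])
  have sym: "Re (cdot v (B *v w)) = Re (cdot w (B *v v))"
    using assms(1) unfolding selfadjoint_def by (metis cdot_matrix inner_commute inner_eq_Re_cdot)
  have "4 * Re (cdot w (B *v v)) =
      Re (cdot (w + v) (B *v (w + v))) - Re (cdot (w - v) (B *v (w - v)))"
    using sym by (simp add: cdot_add_left cdot_add_right cdot_diff_left cdot_diff_right
        matrix_vector_right_distrib matrix_vector_mult_diff_distrib)
  also have "\<dots> \<le> (norm (w + v))\<^sup>2 + (norm (w - v))\<^sup>2"
    using bound[of "w + v"] bound[of "w - v"] by linarith
  also have "\<dots> = 2 * (norm w)\<^sup>2 + 2 * (norm v)\<^sup>2"
    by (simp add: power2_norm_eq_inner inner_add_left inner_add_right inner_diff_left inner_diff_right)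
  finally have "(norm w)\<^sup>2 \<le> (norm v)\<^sup>2"
    by (simp add: w_def[symmetric] cdot_self)
  then show "norm (B *v v) \<le> norm v"
    by (simp add: w_def)
qed

lemma psd_one_add_contraction:
  assumes "selfadjoint B" "contraction B"
  shows "psd (mat 1 + B)"
proof -
  have "0 \<le> Re (cdot v ((mat 1 + B) *v v))" for v
  proof -
    have "cmod (cdot v (B *v v)) \<le> norm v * norm (B *v v)"
      by (rule norm_cdot_le)
    also have "\<dots> \<le> (norm v)\<^sup>2"
      using assms(2) by (simp add: contraction_def power2_eq_square mult_left_mono)
    finally have "- Re (cdot v (B *v v)) \<le> (norm v)\<^sup>2"
      using abs_Re_le_cmod[of "cdot v (B *v v)"] by linarith
    then show ?thesis
      by (simp add: matrix_vector_mult_add_rdistrib cdot_add_right cdot_self)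
  qed
  then show ?thesis
    using assms(1) by (simp add: psd_iff_cdot selfadjoint_def adjoint_mat_add)
qed

lemma psd_imp_adjoint_mult:
  fixes A :: "complex^'n^'n"
  assumes "psd A"
  obtains D :: "complex^'n^'n" where "A = adjoint_mat D ** D"
proof -
  obtain V :: "complex^'n^'n" and d where "adjoint_mat V ** V = mat 1"
    and V: "A = V ** rdiag d ** adjoint_mat V" and d: "\<And>i. 0 \<le> d i"
    by (rule psd_spectral[OF assms]) (rule that)
  define e where "e i = sqrt (d i)" for i
  have "d = (\<lambda>i. e i * e i)"
    using d by (simp add: e_def)
  then have "A = adjoint_mat (rdiag e ** adjoint_mat V) ** (rdiag e ** adjoint_mat V)"
    unfolding V by (simp add: adjoint_mat_mult matrix_mul_assoc flip: rdiag_mult)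
  then show ?thesis by (rule that)
qed

text \<open>Replaces the supremum by a homogeneous inequality, the form in which norm bounds are
  handled below.\<close>

lemma op_norm_le_1_iff:
  assumes "finite I"
  shows "op_norm I A \<le> 1 \<longleftrightarrow>
    (\<forall>v. (\<Sum>i\<in>I. (cmod (\<Sum>j\<in>I. A i j * v j))\<^sup>2) \<le> (\<Sum>j\<in>I. (cmod (v j))\<^sup>2))"
proof -
  define q where "q v = (\<Sum>i\<in>I. (cmod (\<Sum>j\<in>I. A i j * v j))\<^sup>2)" for v
  define s where "s v = (\<Sum>j\<in>I. (cmod (v j))\<^sup>2)" for v :: "'a \<Rightarrow> complex"
  define K where "K = {sqrt (q v) | v. s v \<le> 1}"
  have op: "op_norm I A = Sup K"
    by (simp add: op_norm_def K_def q_def s_def)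
  have "K \<noteq> {}"
    unfolding K_def by (auto intro!: exI[of _ "\<lambda>_. 0"] simp: s_def)
  have s_nonneg: "0 \<le> s v" for v
    by (simp add: s_def sum_nonneg)
  \<comment> \<open>The real-valued \<open>Sup\<close> is meaningful only for bounded sets; a crude
    entrywise estimate provides the bound.\<close>
  have "bdd_above K"
  proof (rule bdd_aboveI)
    fix x assume "x \<in> K"
    then obtain v where v: "x = sqrt (q v)" "s v \<le> 1"
      by (auto simp: K_def)
    have v1: "cmod (v j) \<le> 1" if "j \<in> I" for j
    proof -
      have "(cmod (v j))\<^sup>2 \<le> s v"
        unfolding s_def using that assms by (intro member_le_sum) auto
      with v(2) show ?thesis
        by (metis abs_norm_cancel abs_square_le_1 order_trans)
    qed
    have "q v \<le> (\<Sum>i\<in>I. (\<Sum>j\<in>I. cmod (A i j))\<^sup>2)"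
      unfolding q_def
      by (intro sum_mono power_mono sum_norm_le) (auto simp: norm_mult v1 mult_left_le)
    then show "x \<le> sqrt (\<Sum>i\<in>I. (\<Sum>j\<in>I. cmod (A i j))\<^sup>2)"
      by (simp add: v(1))
  qed
  have "Sup K \<le> 1 \<longleftrightarrow> (\<forall>v. q v \<le> s v)"
  proof
    assume le: "Sup K \<le> 1"
    show "\<forall>v. q v \<le> s v"
    proof
      fix v
      show "q v \<le> s v"
      proof (cases "s v = 0")
        case True
        then have "v j = 0" if "j \<in> I" for j
          using assms that by (simp add: s_def sum_nonneg_eq_0_iff)
        then show ?thesis
          using True by (simp add: q_def)
      next
        case False
        define r where "r = sqrt (s v)"
        have r: "r > 0" "r\<^sup>2 = s v"
          using False s_nonneg[of v] by (auto simp: r_def)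
        define w where "w j = v j / of_real r" for j
        have "s w = s v / r\<^sup>2"
          using r(1) by (simp add: s_def w_def norm_divide power_divide sum_divide_distrib)
        then have "s w \<le> 1"
          using r False by simp
        then have "sqrt (q w) \<le> Sup K"
          using \<open>bdd_above K\<close> by (intro cSup_upper) (auto simp: K_def)
        then have "q w \<le> 1"
          using le by (smt (verit) real_sqrt_le_1_iff)
        moreover have "q w = q v / r\<^sup>2"
          using r(1) by (simp add: q_def w_def norm_divide power_divide flip: sum_divide_distrib)
        ultimately show ?thesis
          using False s_nonneg[of v] by (simp add: r(2) divide_le_eq)
      qed
    qed
  next
    assume le: "\<forall>v. q v \<le> s v"
    have "q v \<le> 1" if "s v \<le> 1" for v
      using le that order_trans by blast
    then show "Sup K \<le> 1"
      using \<open>K \<noteq> {}\<close> by (intro cSup_least) (auto simp: K_def)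
  qed
  then show ?thesis
    by (simp add: op q_def s_def)
qed

text \<open>Relabelling indices preserves the norm. It mediates between the type \<open>'n\<close>,
  the sets \<open>{..<n}\<close>, one-point factors and the two orders of a tensor product.\<close>

lemma op_norm_le_1_transfer:
  assumes "bij_betw h J I" "finite J" "op_norm J B \<le> 1"
    and "\<And>i j. i \<in> J \<Longrightarrow> j \<in> J \<Longrightarrow> A (h i) (h j) = B i j"
  shows "op_norm I A \<le> 1"
proof -
  have "finite I"
    using assms(1,2) by (simp add: bij_betw_finite)
  have "(\<Sum>i\<in>I. (cmod (\<Sum>j\<in>I. A i j * v j))\<^sup>2) \<le> (\<Sum>j\<in>I. (cmod (v j))\<^sup>2)" for v
  proof -
    have "(\<Sum>i\<in>I. (cmod (\<Sum>j\<in>I. A i j * v j))\<^sup>2)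
        = (\<Sum>i\<in>J. (cmod (\<Sum>j\<in>J. A (h i) (h j) * v (h j)))\<^sup>2)"
      by (simp add: sum.reindex_bij_betw[OF assms(1), symmetric])
    also have "\<dots> = (\<Sum>i\<in>J. (cmod (\<Sum>j\<in>J. B i j * v (h j)))\<^sup>2)"
      using assms(4) by simp
    also have "\<dots> \<le> (\<Sum>j\<in>J. (cmod (v (h j)))\<^sup>2)"
      by (rule spec[OF iffD1[OF op_norm_le_1_iff[OF assms(2)] assms(3)]])
    also have "\<dots> = (\<Sum>j\<in>I. (cmod (v j))\<^sup>2)"
      by (simp add: sum.reindex_bij_betw[OF assms(1), symmetric])
    finally show ?thesis .
  qed
  then show ?thesis
    by (simp add: op_norm_le_1_iff[OF \<open>finite I\<close>])
qed

lemma op_norm_le_1_cong: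
  assumes "finite I" "op_norm I B \<le> 1" "\<And>i j. i \<in> I \<Longrightarrow> j \<in> I \<Longrightarrow> A i j = B i j"
  shows "op_norm I A \<le> 1"
  using op_norm_le_1_transfer[of id I I B A] assms by simp

lemma op_norm_bilinear_le:
  assumes "finite I" "op_norm I A \<le> 1"
  shows "cmod (\<Sum>i\<in>I. cnj (u i) * (\<Sum>j\<in>I. A i j * v j))
    \<le> L2_set (\<lambda>i. cmod (u i)) I * L2_set (\<lambda>i. cmod (v i)) I"
proof -
  have "cmod (\<Sum>i\<in>I. cnj (u i) * (\<Sum>j\<in>I. A i j * v j))
      \<le> (\<Sum>i\<in>I. \<bar>cmod (u i)\<bar> * \<bar>cmod (\<Sum>j\<in>I. A i j * v j)\<bar>)"
    by (rule order_trans[OF norm_sum]) (simp add: norm_mult)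
  also have "\<dots> \<le> L2_set (\<lambda>i. cmod (u i)) I * L2_set (\<lambda>i. cmod (\<Sum>j\<in>I. A i j * v j)) I"
    by (rule L2_set_mult_ineq)
  also have "\<dots> \<le> L2_set (\<lambda>i. cmod (u i)) I * L2_set (\<lambda>i. cmod (v i)) I"
    using assms(2) unfolding op_norm_le_1_iff[OF assms(1)]
    by (intro mult_left_mono L2_set_nonneg) (simp add: L2_set_def)
  finally show ?thesis .
qed

lemma contraction_iff_op_norm: "contraction W \<longleftrightarrow> op_norm UNIV (\<lambda>i j. W $ i $ j) \<le> 1"
proof -
  have "norm (W *v v) \<le> norm v \<longleftrightarrow>
     (\<Sum>i\<in>UNIV. (cmod (\<Sum>j\<in>UNIV. W $ i $ j * v $ j))\<^sup>2) \<le> (\<Sum>j\<in>UNIV. (cmod (v $ j))\<^sup>2)" for v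
    by (simp add: norm_vec_def L2_set_def matrix_vector_mult_def)
  note this[of "\<chi> j. w j" for w, simplified] this
  then show ?thesis
    unfolding contraction_def op_norm_le_1_iff[OF finite] by blast
qed

lemma sum_Times: "sum h (A \<times> B) = (\<Sum>a\<in>A. \<Sum>b\<in>B. h (a, b))"
  by (simp add: sum.cartesian_product)

text \<open>The hypothesis says that the matrix with rows \<open>g r\<close> is an isometry; the
  equation is the isometry property of its tensor product with the identity on
  \<open>\<ell>\<^sub>2(I)\<close>.\<close>

lemma L2_set_partition_isometry:
  fixes g :: "'r \<Rightarrow> 'n::finite \<Rightarrow> complex"
  assumes "\<And>k l. (\<Sum>r\<in>R. cnj (g r k) * g r l) = (if k = l then 1 else 0)"
  shows "L2_set (\<lambda>r. L2_set (\<lambda>i. cmod (\<Sum>l\<in>UNIV. g r l * v (i, l))) I) R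
    = L2_set (\<lambda>i. cmod (v i)) (I \<times> UNIV)"
proof -
  have "(\<Sum>r\<in>R. \<Sum>i\<in>I. (cmod (\<Sum>l\<in>UNIV. g r l * v (i, l)))\<^sup>2) = (\<Sum>i\<in>I. \<Sum>l\<in>UNIV. (cmod (v (i, l)))\<^sup>2)"
  proof (subst sum.swap, rule sum.cong[OF refl])
    fix i
    have "complex_of_real (\<Sum>r\<in>R. (cmod (\<Sum>l\<in>UNIV. g r l * v (i, l)))\<^sup>2)
        = (\<Sum>r\<in>R. \<Sum>k\<in>UNIV. \<Sum>l\<in>UNIV. cnj (g r k) * g r l * (cnj (v (i, k)) * v (i, l)))"
      unfolding of_real_sum complex_norm_square cnj_sum sum_product
      by (subst sum.swap) (simp add: mult_ac)
    also have "\<dots> = (\<Sum>k\<in>UNIV. \<Sum>l\<in>UNIV. (\<Sum>r\<in>R. cnj (g r k) * g r l) * (cnj (v (i, k)) * v (i, l)))"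
      unfolding sum_distrib_right by (subst sum.swap, rule sum.cong[OF refl], rule sum.swap)
    also have "\<dots> = (\<Sum>k\<in>UNIV. cnj (v (i, k)) * v (i, k))"
      unfolding assms by (simp add: if_distrib [of "\<lambda>x. x * _"] cong: if_cong)
    also have "\<dots> = complex_of_real (\<Sum>k\<in>UNIV. (cmod (v (i, k)))\<^sup>2)"
      unfolding of_real_sum complex_norm_square by (simp add: mult.commute)
    finally show "(\<Sum>r\<in>R. (cmod (\<Sum>l\<in>UNIV. g r l * v (i, l)))\<^sup>2) = (\<Sum>k\<in>UNIV. (cmod (v (i, k)))\<^sup>2)"
      by (simp only: of_real_eq_iff)
  qed
  then show ?thesis
    by (simp add: L2_set_def sum_nonneg sum.cartesian_product)
qed

text \<open>Cauchy-Schwarz over the partition of unity \<open>\<Sum>\<^sub>r g\<^sub>r\<^sup>* g\<^sub>r = 1\<close>.\<close>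

lemma op_norm_partition_le_1:
  fixes g :: "'r \<Rightarrow> 'n::finite \<Rightarrow> complex"
  assumes "finite I" and f: "\<And>r. r \<in> R \<Longrightarrow> op_norm I (f r) \<le> 1"
    and g: "\<And>k l. (\<Sum>r\<in>R. cnj (g r k) * g r l) = (if k = l then 1 else 0)"
  shows "op_norm (I \<times> UNIV) (\<lambda>(i, k) (j, l). \<Sum>r\<in>R. f r i j * (cnj (g r k) * g r l)) \<le> 1"
proof -
  define M where "M = (\<lambda>(i, k) (j, l). \<Sum>r\<in>R. f r i j * (cnj (g r k) * g r l))"
  have fin: "finite (I \<times> (UNIV :: 'n set))"
    using assms(1) by simp
  define n where "n v = L2_set (\<lambda>i. cmod (v i)) (I \<times> UNIV)" for v :: "'a \<times> 'n \<Rightarrow> complex"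
  define G where "G v r i = (\<Sum>l\<in>UNIV. g r l * v (i, l))" for v r and i :: 'a
  have bil: "cmod (\<Sum>x\<in>I \<times> UNIV. cnj (u x) * (\<Sum>y\<in>I \<times> UNIV. M x y * v y)) \<le> n u * n v" for u v
  proof -
    have "(\<Sum>x\<in>I \<times> UNIV. cnj (u x) * (\<Sum>y\<in>I \<times> UNIV. M x y * v y))
        = (\<Sum>i\<in>I. \<Sum>k\<in>UNIV. \<Sum>j\<in>I. \<Sum>l\<in>UNIV. \<Sum>r\<in>R.
            cnj (u (i, k)) * (f r i j * (cnj (g r k) * g r l) * v (j, l)))"
      by (simp add: M_def sum_distrib_left sum_distrib_right sum_Times)
    also have "\<dots> = (\<Sum>r\<in>R. \<Sum>i\<in>I. \<Sum>k\<in>UNIV. \<Sum>j\<in>I. \<Sum>l\<in>UNIV.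
            cnj (u (i, k)) * (f r i j * (cnj (g r k) * g r l) * v (j, l)))"
      by (simp only: sum.swap[of _ R])
    \<comment> \<open>Each summand over \<open>r\<close> becomes the sesquilinear form of
      \<open>f r\<close> at the slices \<open>G u r\<close> and \<open>G v r\<close>.\<close>
    also have "\<dots> = (\<Sum>r\<in>R. \<Sum>i\<in>I. cnj (G u r i) * (\<Sum>j\<in>I. f r i j * G v r j))"
      unfolding G_def
      apply (simp add: sum_distrib_left sum_distrib_right mult_ac)
      apply (intro sum.cong refl)
      apply (rule trans[OF sum.swap])
      apply (rule sum.cong[OF refl])
      apply (rule sum.swap)
      done
    also have "cmod \<dots> \<le> (\<Sum>r\<in>R. \<bar>L2_set (\<lambda>i. cmod (G u r i)) I\<bar> * \<bar>L2_set (\<lambda>i. cmod (G v r i)) I\<bar>)"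
      using op_norm_bilinear_le[OF assms(1) f] by (intro sum_norm_le) (simp add: L2_set_nonneg)
    also have "\<dots> \<le> L2_set (\<lambda>r. L2_set (\<lambda>i. cmod (G u r i)) I) R * L2_set (\<lambda>r. L2_set (\<lambda>i. cmod (G v r i)) I) R"
      by (rule L2_set_mult_ineq)
    also have "\<dots> = n u * n v"
      unfolding G_def n_def by (simp add: L2_set_partition_isometry[OF g])
    finally show ?thesis .
  qed
  have "(\<Sum>i\<in>I\<times>UNIV. (cmod (\<Sum>j\<in>I\<times>UNIV. M i j * v j))\<^sup>2) \<le> (\<Sum>j\<in>I\<times>UNIV. (cmod (v j))\<^sup>2)" for v
  proof -
    \<comment> \<open>The sesquilinear bound is applied with the image \<open>w\<close> of
      \<open>v\<close> as first argument, which turns it into a norm bound.\<close>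
    define w where "w i = (\<Sum>j\<in>I\<times>UNIV. M i j * v j)" for i
    have sq: "(n u)\<^sup>2 = (\<Sum>i\<in>I\<times>UNIV. (cmod (u i))\<^sup>2)" for u
      by (simp add: n_def L2_set_def sum_nonneg)
    have n0: "0 \<le> n u" for u
      by (simp add: n_def L2_set_nonneg)
    have "(\<Sum>x\<in>I \<times> UNIV. cnj (w x) * w x) = of_real ((n w)\<^sup>2)"
      unfolding sq of_real_sum complex_norm_square by (simp add: mult.commute)
    then have "(n w)\<^sup>2 = cmod (\<Sum>x\<in>I \<times> UNIV. cnj (w x) * w x)"
      by (simp add: norm_power)
    also have "\<dots> \<le> n w * n v"
      using bil[of w v] by (simp add: w_def)
    finally have "n w \<le> n v"
      using n0[of w] n0[of v] by (cases "n w = 0") (auto simp: power2_eq_square)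
    then have "(n w)\<^sup>2 \<le> (n v)\<^sup>2"
      using n0 by (simp add: power_mono)
    then show ?thesis
      by (simp add: sq w_def)
  qed
  then show ?thesis
    unfolding M_def[symmetric] op_norm_le_1_iff[OF fin] by blast
qed


subsection \<open>Duality for measurements\<close>

lemma matrix_mult_scaleR_left: "(r *\<^sub>R A) ** B = r *\<^sub>R (A ** B)"
  for A :: "complex^'n^'m"
  by (simp add: matrix_matrix_mult_def vec_eq_iff scaleR_sum_right)

lemma matrix_mult_scaleR_right: "A ** (r *\<^sub>R B) = r *\<^sub>R (A ** B)"
  for A :: "complex^'n^'m"
  by (simp add: matrix_matrix_mult_def vec_eq_iff scaleR_sum_right)

text \<open>The type class inner product is the real part of the Hilbert-Schmidt one, so hyperplane
  separation yields trace functionals.\<close>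

lemma inner_mat_eq_trace: "inner X Y = Re (trace (adjoint_mat X ** Y))"
  for X :: "complex^'n^'n"
  unfolding inner_vec_def trace_def matrix_matrix_mult_def adjoint_mat_def inner_complex_def
  by (simp, subst sum.swap, simp)

lemma inner_adjoint_mat: "inner (adjoint_mat X) (adjoint_mat Y) = inner X Y"
  for X :: "complex^'n^'n"
  unfolding inner_vec_def adjoint_mat_def inner_complex_def
  by (simp, subst sum.swap, simp)

text \<open>The rank-one operator v v^*. Pairing with it evaluates a quadratic form, which tests
  positivity.\<close>

definition outer :: "complex^'n \<Rightarrow> complex^'n^'n" where
  "outer v = (\<chi> i j. v $ i * cnj (v $ j))"

lemma outer_mult: "outer v *v w = (\<chi> i. v $ i * cdot v w)"
  by (simp add: outer_def cdot_def matrix_vector_mult_def vec_eq_iff sum_distrib_left mult.assoc)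

lemma psd_outer: "psd (outer v)"
proof -
  have "cdot w (outer v *v w) = cdot w v * cdot v w" for w
    by (simp add: outer_mult) (simp add: cdot_def sum_distrib_right mult.assoc)
  then have "cdot w (outer v *v w) = of_real ((cmod (cdot v w))\<^sup>2)" for w
    by (simp only: complex_norm_square cnj_cdot mult.commute)
  then show ?thesis
    by (simp add: psd_iff_cdot selfadjoint_def) (simp add: outer_def adjoint_mat_def vec_eq_iff mult.commute)
qed

lemma inner_outer: "inner (outer v) A = Re (cdot v (A *v v))"
proof -
  have "inner (outer v) A = Re (\<Sum>i\<in>UNIV. \<Sum>j\<in>UNIV. cnj (v $ i) * (A $ i $ j * v $ j))"
    unfolding inner_vec_def outer_def inner_complex_def Re_sum
    by (intro sum.cong refl) (simp add: algebra_simps)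
  then show ?thesis
    by (simp add: cdot_def matrix_vector_mult_def sum_distrib_left)
qed

text \<open>The trace of \<open>adjoint_mat D ** D\<close> is the squared length of the vector
  formed by all entries of \<open>D\<close>.\<close>

lemma inner_adjoint_mult_one: "inner (adjoint_mat D ** D) (mat 1) = (\<Sum>p\<in>UNIV. \<Sum>i\<in>UNIV. (cmod (D $ p $ i))\<^sup>2)"
  for D :: "complex^'n^'n"
proof -
  have "inner (adjoint_mat D ** D) (mat 1) = inner D D"
    by (simp add: inner_mat_eq_trace adjoint_mat_mult)
  then show ?thesis
    by (simp add: inner_vec_def power2_norm_eq_inner)
qed

text \<open>The primal problem maximises \<open>\<Sum>\<^sub>j tr (E\<^sub>j H\<^sub>j)\<close> over measurements \<open>E\<close>; \<open>Z\<close> is a feasible point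
  of the dual one.  It is read off a hyperplane separating \<open>{1} \<times> {b<..}\<close> from the cone of all
  \<open>(\<Sum>\<^sub>j E\<^sub>j + W, r)\<close> with \<open>E\<^sub>j\<close> positive, \<open>r \<le> \<Sum>\<^sub>j tr (E\<^sub>j H\<^sub>j)\<close> and \<open>W\<close> antihermitian; including \<open>W\<close>
  makes \<open>Z\<close> selfadjoint.\<close>

lemma measurement_duality:
  fixes H :: "'j \<Rightarrow> complex^'n^'n"
  assumes "finite J" "J \<noteq> {}" and H: "\<And>j. j \<in> J \<Longrightarrow> selfadjoint (H j)"
    and le: "\<And>E. (\<And>j. j \<in> J \<Longrightarrow> psd (E j)) \<Longrightarrow> (\<Sum>j\<in>J. E j) = mat 1 \<Longrightarrow>
      (\<Sum>j\<in>J. inner (E j) (H j)) \<le> b"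
  obtains Z where "inner Z (mat 1) \<le> b" "\<And>j. j \<in> J \<Longrightarrow> psd (Z - H j)"
proof -
  define S where "S = {mat 1 :: complex^'n^'n} \<times> {b<..}"
  define T where "T = {((\<Sum>j\<in>J. E j) + W, r) | E W r. (\<forall>j\<in>J. psd (E j)) \<and> adjoint_mat W = - W \<and>
    r \<le> (\<Sum>j\<in>J. inner (E j) (H j))}"
  have TI: "((\<Sum>j\<in>J. E j) + W, r) \<in> T"
    if "\<And>j. j \<in> J \<Longrightarrow> psd (E j)" "adjoint_mat W = - W" "r \<le> (\<Sum>j\<in>J. inner (E j) (H j))" for E W r
    using that unfolding T_def by blast
  have T_scale: "t *\<^sub>R x \<in> T" if x: "x \<in> T" and t: "0 \<le> t" for t x
  proof -
    obtain E W r where E: "x = ((\<Sum>j\<in>J. E j) + W, r)" "\<And>j. j \<in> J \<Longrightarrow> psd (E j)" "adjoint_mat W = - W"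
      "r \<le> (\<Sum>j\<in>J. inner (E j) (H j))"
      using x unfolding T_def by blast
    have "((\<Sum>j\<in>J. t *\<^sub>R E j) + t *\<^sub>R W, t * r) \<in> T"
      using E t by (intro TI) (auto simp: psd_scaleR adjoint_mat_scaleR mult_left_mono simp flip: sum_distrib_left)
    then show ?thesis
      by (simp add: E(1) scaleR_add_right scaleR_sum_right)
  qed
  have T_add: "x + y \<in> T" if x: "x \<in> T" and y: "y \<in> T" for x y
  proof -
    obtain E W r where E: "x = ((\<Sum>j\<in>J. E j) + W, r)" "\<And>j. j \<in> J \<Longrightarrow> psd (E j)" "adjoint_mat W = - W"
      "r \<le> (\<Sum>j\<in>J. inner (E j) (H j))"
      using x unfolding T_def by blast
    obtain E' W' r' where E': "y = ((\<Sum>j\<in>J. E' j) + W', r')" "\<And>j. j \<in> J \<Longrightarrow> psd (E' j)" "adjoint_mat W' = - W'"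
      "r' \<le> (\<Sum>j\<in>J. inner (E' j) (H j))"
      using y unfolding T_def by blast
    have "((\<Sum>j\<in>J. E j + E' j) + (W + W'), r + r') \<in> T"
      using E E' by (intro TI) (auto simp: psd_add adjoint_mat_add inner_add_left sum.distrib)
    then show ?thesis
      by (simp add: E(1) E'(1) sum.distrib algebra_simps)
  qed
  have "convex T"
    by (intro convexI T_add T_scale)
  moreover have "convex S"
    unfolding S_def by (intro convex_Times) auto
  moreover have "S \<noteq> {}"
    unfolding S_def by (auto intro: gt_ex)
  moreover have zero: "0 \<in> T"
    using TI[of "\<lambda>_. 0" 0 0] by (simp add: psd_zero zero_prod_def)
  \<comment> \<open>At a common point \<open>W\<close> is both selfadjoint and antihermitian, hence
    0, and \<open>E\<close> is a measurement of value above \<open>b\<close>.\<close>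
  moreover have "S \<inter> T = {}"
  proof (rule ccontr)
    assume "S \<inter> T \<noteq> {}"
    then obtain r E W where r: "r > b" and E: "mat 1 = (\<Sum>j\<in>J. E j) + W" "\<And>j. j \<in> J \<Longrightarrow> psd (E j)"
      "adjoint_mat W = - W" "r \<le> (\<Sum>j\<in>J. inner (E j) (H j))"
      unfolding S_def T_def by blast
    have "W = mat 1 - (\<Sum>j\<in>J. E j)"
      using E(1) by simp
    then have "adjoint_mat W = W"
      using E(2) by (simp add: adjoint_mat_diff adjoint_mat_sum psd_def selfadjoint_def)
    then have "W = 0"
      using E(3) by (metis eq_neg_iff_add_eq_0 scaleR_2 scaleR_eq_0_iff zero_neq_numeral)
    then show False
      using le[of E] E r by simp
  qed
  ultimately obtain a c where a: "a \<noteq> 0" "\<And>x. x \<in> S \<Longrightarrow> inner a x \<le> c" "\<And>x. x \<in> T \<Longrightarrow> c \<le> inner a x"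
    using separating_hyperplane_sets[of S T] by blast
  obtain Z0 m where Z0: "a = (Z0, m)"
    by (cases a)
  have "c \<le> 0"
    using a(3)[OF zero] by simp
  have T_nonneg: "0 \<le> inner a x" if "x \<in> T" for x
  proof (rule ccontr)
    assume neg: "\<not> 0 \<le> inner a x"
    \<comment> \<open>A functional bounded below on a cone is nonnegative there: this factor would
      scale a negative value to \<open>- (\<bar>c\<bar> + 1)\<close>, which is below
      \<open>c\<close>.\<close>
    define t where "t = (\<bar>c\<bar> + 1) / (- inner a x)"
    have "c \<le> inner a (t *\<^sub>R x)"
      using neg that by (intro a(3) T_scale) (auto simp: t_def divide_simps)
    also have "\<dots> = - (\<bar>c\<bar> + 1)"
      using neg by (simp add: t_def)
    finally show False by linarith
  qed
  define k where "k = inner Z0 (mat 1) + m * b"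
  \<comment> \<open>The separation evaluated at the point of \<open>S\<close> with height
    \<open>b + e\<close>. Large \<open>e\<close> forces \<open>m \<le> 0\<close>, small
    \<open>e\<close> forces \<open>k \<le> 0\<close>.\<close>
  have k: "k + m * e \<le> 0" if "e > 0" for e
    using a(2)[of "(mat 1, b + e)"] that \<open>c \<le> 0\<close> by (simp add: S_def Z0 k_def algebra_simps)
  have "m \<le> 0"
  proof (rule ccontr)
    assume "\<not> m \<le> 0"
    moreover have "0 < \<bar>k\<bar> + 1"
      by linarith
    ultimately show False
      using k[of "(\<bar>k\<bar> + 1) / m"] by (simp add: divide_simps split: if_splits)
  qed
  have "k \<le> 0"
  proof (rule field_le_epsilon)
    fix e :: real assume "e > 0"
    then have "k + m * (e / (\<bar>m\<bar> + 1)) \<le> 0"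
      by (intro k) (simp add: add_nonneg_pos)
    moreover have "\<bar>m\<bar> * e / (\<bar>m\<bar> + 1) \<le> e"
      using \<open>e > 0\<close> by (simp add: divide_simps add_nonneg_pos)
    ultimately show "k \<le> 0 + e"
      using \<open>m \<le> 0\<close> by simp
  qed
  \<comment> \<open>Both \<open>W\<close> and \<open>- W\<close> lie in the cone with height 0.
    Applied to the antihermitian part of \<open>Z0\<close>, this shows that \<open>Z0\<close> is
    selfadjoint.\<close>
  have antiherm: "inner Z0 W = 0" if "adjoint_mat W = - W" for W
  proof -
    have "0 \<le> inner a (W', 0)" if "adjoint_mat W' = - W'" for W'
      using TI[of "\<lambda>_. 0" W' 0] that by (intro T_nonneg) (simp add: psd_zero)
    from this[of W] this[of "- W"] that show ?thesis
      by (simp add: Z0 adjoint_mat_minus)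
  qed
  define W0 where "W0 = Z0 - adjoint_mat Z0"
  have W0: "adjoint_mat W0 = - W0"
    by (simp add: W0_def adjoint_mat_diff)
  have "inner (adjoint_mat Z0) W0 = inner Z0 (adjoint_mat W0)"
    using inner_adjoint_mat[of Z0 "adjoint_mat W0"] by simp
  then have "inner (Z0 - adjoint_mat Z0) W0 = 0"
    using antiherm[OF W0] by (simp add: W0 inner_diff_left)
  then have "inner W0 W0 = 0"
    by (simp only: W0_def [symmetric])
  then have Z0_adj: "adjoint_mat Z0 = Z0"
    by (simp add: W0_def)
  have psd: "psd (Z0 + m *\<^sub>R H j)" if "j \<in> J" for j
  proof -
    have "0 \<le> Re (cdot v ((Z0 + m *\<^sub>R H j) *v v))" for v
    proof -
      \<comment> \<open>A rank-one operator at the single outcome \<open>j\<close> tests positivity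
        in the direction \<open>v\<close>.\<close>
      define E where "E i = (if i = j then outer v else 0)" for i
      have "((\<Sum>i\<in>J. E i) + 0, inner (outer v) (H j)) \<in> T"
        using that assms(1)
        by (intro TI) (auto simp: E_def psd_outer psd_zero if_distrib [of "\<lambda>x. inner x _"] cong: if_cong)
      then have "0 \<le> inner a (outer v, inner (outer v) (H j))"
        using that assms(1) T_nonneg by (simp add: E_def)
      then have "0 \<le> inner (outer v) (Z0 + m *\<^sub>R H j)"
        by (simp add: Z0 inner_add_right inner_commute)
      then show ?thesis
        by (simp add: inner_outer)
    qed
    then show ?thesis
      using H[OF that] Z0_adj by (simp add: psd_iff_cdot selfadjoint_def adjoint_mat_add adjoint_mat_scaleR)
  qed
  \<comment> \<open>The hyperplane is not vertical: otherwise \<open>Z0\<close> would be positive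
    with nonpositive trace, hence 0, and the whole functional \<open>a\<close> would vanish.\<close>
  have "m \<noteq> 0"
  proof
    assume "m = 0"
    then have "psd Z0"
      using psd assms(2) by auto
    then obtain D :: "complex^'n^'n" where D: "Z0 = adjoint_mat D ** D"
      by (rule psd_imp_adjoint_mult)
    have "(\<Sum>p\<in>UNIV. \<Sum>i\<in>UNIV. (cmod (D $ p $ i))\<^sup>2) \<le> 0"
      using \<open>k \<le> 0\<close> by (simp add: k_def \<open>m = 0\<close> D inner_adjoint_mult_one)
    then have "(\<Sum>p\<in>UNIV. \<Sum>i\<in>UNIV. (cmod (D $ p $ i))\<^sup>2) = 0"
      by (intro antisym sum_nonneg) auto
    then have "D = 0"
      by (simp add: sum_nonneg_eq_0_iff sum_nonneg vec_eq_iff)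
    then show False
      using a(1) by (simp add: Z0 \<open>m = 0\<close> D zero_prod_def)
  qed
  with \<open>m \<le> 0\<close> have m: "m < 0" by simp
  define Z where "Z = (1 / - m) *\<^sub>R Z0"
  have "inner Z (mat 1) \<le> b"
    using \<open>k \<le> 0\<close> m by (simp add: Z_def k_def divide_simps mult.commute)
  moreover have "psd (Z - H j)" if "j \<in> J" for j
  proof -
    have "Z - H j = (1 / - m) *\<^sub>R (Z0 + m *\<^sub>R H j)"
      using m by (simp add: Z_def scaleR_add_right)
    then show ?thesis
      using psd[OF that] m by (simp only:) (intro psd_scaleR, simp)
  qed
  ultimately show ?thesis by (rule that)
qed

text \<open>A selfadjoint \<open>H\<^sub>k\<close> between \<open>-Z\<close> and \<open>Z\<close> factors as \<open>D\<^sup>* C\<^sub>k D\<close> with \<open>C\<^sub>k\<close> a contraction and \<open>D\<^sup>* D\<close>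
  equal to \<open>Z\<close>, up to a perturbation that makes \<open>D\<close> invertible.  The entries of \<open>D\<close> then form a
  vector at which the quadratic form of \<open>\<Sum>\<^sub>k C\<^sub>k \<otimes> X\<^sub>k\<close> is the pairing of \<open>X\<close> with \<open>H\<close>.\<close>

lemma norm_pairing_le:
  fixes X H :: "nat \<Rightarrow> complex^'n^'n"
  assumes N: "0 < N"
    and X: "\<And>C :: nat \<Rightarrow> complex^'n^'n. (\<And>k. k < N \<Longrightarrow> contraction (C k)) \<Longrightarrow>
      op_norm (UNIV \<times> UNIV) (\<lambda>(p, i) (q, j). \<Sum>k<N. C k $ p $ q * X k $ i $ j) \<le> 1"
    and H: "\<And>k. k < N \<Longrightarrow> psd (Z - H k)" "\<And>k. k < N \<Longrightarrow> psd (Z + H k)"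
    and b: "inner Z (mat 1) \<le> b"
  shows "cmod (\<Sum>k<N. \<Sum>i\<in>UNIV. \<Sum>j\<in>UNIV. X k $ i $ j * H k $ i $ j) \<le> b"
proof (rule field_le_epsilon)
  fix e :: real assume "e > 0"
  \<comment> \<open>Chosen so that adding \<open>\<delta> *\<^sub>R mat 1\<close> to
    \<open>Z\<close> raises the trace by exactly \<open>e\<close>.\<close>
  define \<delta> where "\<delta> = e / CARD('n)"
  have \<delta>: "\<delta> > 0"
    using \<open>e > 0\<close> by (simp add: \<delta>_def)
  \<comment> \<open>\<open>Z\<close> is the mean of the two positive matrices belonging to index 0,
    which exists because \<open>0 < N\<close>.\<close>
  have "psd ((1 / 2) *\<^sub>R ((Z - H 0) + (Z + H 0)))"
    using H[of 0] N by (intro psd_scaleR psd_add[of "Z - H 0"]) auto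
  moreover have "(1 / 2) *\<^sub>R ((Z - H 0) + (Z + H 0)) = Z"
    by (simp flip: scaleR_2)
  ultimately have "psd Z"
    by simp
  then obtain V :: "complex^'n^'n" and d where V: "adjoint_mat V ** V = mat 1" "V ** adjoint_mat V = mat 1"
    "Z = V ** rdiag d ** adjoint_mat V" and d: "\<And>i. 0 \<le> d i"
    by (rule psd_spectral) (rule that)
  define s where "s i = sqrt (d i + \<delta>)" for i
  have s: "s i > 0" "s i * s i = d i + \<delta>" for i
    using d[of i] \<delta> by (auto simp: s_def)
  define D where "D = rdiag s ** adjoint_mat V"
  define D' where "D' = V ** rdiag (\<lambda>i. 1 / s i)"
  have one: "rdiag (\<lambda>i. 1) = mat 1"
    by (simp add: rdiag_def mat_def vec_eq_iff)
  have "D ** D' = rdiag s ** (adjoint_mat V ** V) ** rdiag (\<lambda>i. 1 / s i)"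
    by (simp add: D_def D'_def matrix_mul_assoc)
  also have "\<dots> = mat 1"
    using s(1) by (simp add: V(1) rdiag_mult less_imp_neq[symmetric] one)
  finally have DD': "D ** D' = mat 1" .
  then have D'D: "D' ** D = mat 1"
    by (simp add: matrix_left_right_inverse)
  have s_diag: "rdiag s ** rdiag s = rdiag d + \<delta> *\<^sub>R mat 1"
    unfolding rdiag_mult s(2)
    by (simp add: rdiag_def mat_def vec_eq_iff scaleR_conv_of_real[where 'a = complex])
  have V_diag: "V ** (\<delta> *\<^sub>R mat 1) ** adjoint_mat V = \<delta> *\<^sub>R mat 1"
    using V(2) by (simp add: matrix_mult_scaleR_left matrix_mult_scaleR_right)
  have "adjoint_mat D ** D = V ** (rdiag s ** rdiag s) ** adjoint_mat V"
    by (simp add: D_def adjoint_mat_mult matrix_mul_assoc)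
  also have "\<dots> = V ** rdiag d ** adjoint_mat V + V ** (\<delta> *\<^sub>R mat 1) ** adjoint_mat V"
    unfolding s_diag matrix_add_ldistrib matrix_add_rdistrib ..
  finally have DD: "adjoint_mat D ** D = Z + \<delta> *\<^sub>R mat 1"
    by (simp only: V_diag V(3))
  define C where "C k = adjoint_mat D' ** H k ** D'" for k
  have H_eq: "H k = adjoint_mat D ** C k ** D" for k
  proof -
    have "adjoint_mat D ** C k ** D = adjoint_mat (D' ** D) ** H k ** (D' ** D)"
      by (simp only: C_def adjoint_mat_mult matrix_mul_assoc)
    then show ?thesis
      by (simp add: D'D)
  qed
  have conj_one: "adjoint_mat D' ** (Z + \<delta> *\<^sub>R mat 1) ** D' = mat 1"
  proof -
    have "adjoint_mat D' ** (adjoint_mat D ** D) ** D' = adjoint_mat (D ** D') ** (D ** D')"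
      by (simp only: adjoint_mat_mult matrix_mul_assoc)
    then show ?thesis
      by (simp add: DD DD')
  qed
  \<comment> \<open>Conjugation by \<open>D'\<close> turns
    \<open>Z + \<delta> *\<^sub>R mat 1\<close> into the identity, so the bounds of
    \<open>H k\<close> by this matrix and its negative become bounds of \<open>C k\<close> by 1 and
    -1.\<close>
  have contr: "contraction (C k)" if "k < N" for k
  proof (rule psd_diff_abs_contraction)
    have "selfadjoint (Z + H k)" "selfadjoint Z"
      using H(2)[OF that] \<open>psd Z\<close> by (auto simp: psd_def)
    then show "selfadjoint (C k)"
      by (simp add: C_def selfadjoint_def adjoint_mat_mult adjoint_mat_add matrix_mul_assoc)
    have "psd (adjoint_mat D' ** ((Z - H k) + \<delta> *\<^sub>R mat 1) ** D')"
      using H(1)[OF that] \<delta> by (intro psd_conjugate psd_add psd_scaleR psd_one) auto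
    moreover have "adjoint_mat D' ** ((Z - H k) + \<delta> *\<^sub>R mat 1) ** D'
        = adjoint_mat D' ** (Z + \<delta> *\<^sub>R mat 1) ** D' - C k"
      by (simp add: C_def matrix_add_ldistrib matrix_add_rdistrib matrix_sub_ldistrib matrix_sub_rdistrib)
    ultimately show "psd (mat 1 - C k)"
      by (simp only: conj_one)
    have "psd (adjoint_mat D' ** ((Z + H k) + \<delta> *\<^sub>R mat 1) ** D')"
      using H(2)[OF that] \<delta> by (intro psd_conjugate psd_add[of "Z + H k"] psd_scaleR psd_one) auto
    moreover have "adjoint_mat D' ** ((Z + H k) + \<delta> *\<^sub>R mat 1) ** D'
        = adjoint_mat D' ** (Z + \<delta> *\<^sub>R mat 1) ** D' + C k"
      by (simp add: C_def matrix_add_ldistrib matrix_add_rdistrib)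
    ultimately show "psd (mat 1 + C k)"
      by (simp only: conj_one)
  qed
  define M where "M = (\<lambda>(p, i) (q, j). \<Sum>k<N. C k $ p $ q * X k $ i $ j)"
  define u where "u = (\<lambda>(p, i). D $ p $ i)"
  define F where "F k p i q j = cnj (D $ p $ i) * (C k $ p $ q * X k $ i $ j * D $ q $ j)" for k p i q j
  have pair: "(\<Sum>i\<in>UNIV. \<Sum>j\<in>UNIV. X k $ i $ j * H k $ i $ j)
      = (\<Sum>p\<in>UNIV. \<Sum>i\<in>UNIV. \<Sum>q\<in>UNIV. \<Sum>j\<in>UNIV. F k p i q j)" for k
  proof -
    have "H k = adjoint_mat D ** (C k ** D)"
      using H_eq by (simp add: matrix_mul_assoc)
    then have "H k $ i $ j = (\<Sum>p\<in>UNIV. cnj (D $ p $ i) * (\<Sum>q\<in>UNIV. C k $ p $ q * D $ q $ j))" for i j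
      by (simp add: matrix_matrix_mult_def adjoint_mat_def)
    then have "X k $ i $ j * H k $ i $ j = (\<Sum>p\<in>UNIV. \<Sum>q\<in>UNIV. F k p i q j)" for i j
      by (simp add: F_def sum_distrib_left mult_ac)
    then have "(\<Sum>i\<in>UNIV. \<Sum>j\<in>UNIV. X k $ i $ j * H k $ i $ j)
        = (\<Sum>i\<in>UNIV. \<Sum>j\<in>UNIV. \<Sum>p\<in>UNIV. \<Sum>q\<in>UNIV. F k p i q j)"
      by simp
    also have "\<dots> = (\<Sum>i\<in>UNIV. \<Sum>p\<in>UNIV. \<Sum>j\<in>UNIV. \<Sum>q\<in>UNIV. F k p i q j)"
      by (rule sum.cong[OF refl]) (rule sum.swap)
    also have "\<dots> = (\<Sum>p\<in>UNIV. \<Sum>i\<in>UNIV. \<Sum>j\<in>UNIV. \<Sum>q\<in>UNIV. F k p i q j)"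
      by (rule sum.swap)
    also have "\<dots> = (\<Sum>p\<in>UNIV. \<Sum>i\<in>UNIV. \<Sum>q\<in>UNIV. \<Sum>j\<in>UNIV. F k p i q j)"
      by (rule sum.cong[OF refl], rule sum.cong[OF refl], rule sum.swap)
    finally show ?thesis .
  qed
  have "(\<Sum>k<N. \<Sum>i\<in>UNIV. \<Sum>j\<in>UNIV. X k $ i $ j * H k $ i $ j)
      = (\<Sum>p\<in>UNIV. \<Sum>i\<in>UNIV. \<Sum>q\<in>UNIV. \<Sum>j\<in>UNIV. \<Sum>k<N. F k p i q j)"
    by (simp only: pair sum.swap[of _ "{..<N}"])
  also have "\<dots> = (\<Sum>x\<in>UNIV \<times> UNIV. cnj (u x) * (\<Sum>y\<in>UNIV \<times> UNIV. M x y * u y))"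
    by (simp only: sum_Times) (simp add: u_def M_def F_def sum_distrib_left sum_distrib_right)
  also have "cmod \<dots> \<le> L2_set (\<lambda>x. cmod (u x)) (UNIV \<times> UNIV) * L2_set (\<lambda>x. cmod (u x)) (UNIV \<times> UNIV)"
    using X[OF contr] by (intro op_norm_bilinear_le) (simp_all add: M_def)
  also have "\<dots> = (\<Sum>p\<in>UNIV. \<Sum>i\<in>UNIV. (cmod (D $ p $ i))\<^sup>2)"
    by (simp only: L2_set_def sum_Times) (simp add: u_def sum_nonneg)
  also have "\<dots> = inner Z (mat 1) + \<delta> * inner (mat 1 :: complex^'n^'n) (mat 1)"
    by (simp add: DD inner_add_left flip: inner_adjoint_mult_one)
  also have "inner (mat 1 :: complex^'n^'n) (mat 1) = CARD('n)"
    by (simp add: inner_mat_eq_trace) (simp add: trace_def mat_def)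
  finally show "cmod (\<Sum>k<N. \<Sum>i\<in>UNIV. \<Sum>j\<in>UNIV. X k $ i $ j * H k $ i $ j) \<le> b + e"
    using b by (simp add: \<delta>_def)
qed


subsection \<open>The minimal tensor product with \<open>\<ell>\<^sub>1\<close>\<close>

lemma op_norm_uminus_le_1: "finite I \<Longrightarrow> op_norm I A \<le> 1 \<Longrightarrow> op_norm I (\<lambda>i j. - A i j) \<le> 1"
  by (simp add: op_norm_le_1_iff sum_negf)

text \<open>As a map on \<open>\<open_c0>\<close>-sequences the unit vector is evaluation at
  \<open>r\<close>, which is completely contractive. It thus has norm at most 1, and the first
  amplification of \<open>\<phi>\<close> gives the claim.\<close>

lemma complete_contraction_l1_unit:
  assumes "\<phi> \<in> complete_contractions l1_space p"
  shows "op_norm {..<p} (\<phi> (\<lambda>k. if k = r then 1 else 0)) \<le> 1"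
proof -
  define e where "e k = (if k = r then 1 else 0 :: complex)" for k
  have e_sum: "(\<Sum>k. e k * f k) = f r" for f
    using suminf_finite[of "{r}" "\<lambda>k. e k * f k"] by (simp add: e_def)
  have "(\<lambda>i j. e) \<in> os_mat l1_space 1"
    using summable_finite[of "{r}" "\<lambda>k. cmod (e k)"] by (simp add: os_mat_def l1_space_def e_def)
  moreover have "os_norm l1_space 1 (\<lambda>i j. e) \<le> 1"
  proof -
    have "op_norm ({..<d} \<times> {..<1::nat}) (\<lambda>(i, k) (j, l). f i j r) \<le> 1"
      if "os_norm c0_space d f \<le> 1" for d f
    proof (rule op_norm_le_1_transfer)
      show "bij_betw (\<lambda>i. (i, 0)) {..<d} ({..<d} \<times> {..<1::nat})"
        by (auto simp: bij_betw_def inj_on_def)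
      have "ereal (op_norm {..<d} (\<lambda>i j. f i j r)) \<le> os_norm c0_space d f"
        unfolding c0_space_def
        using SUP_upper[of r UNIV "\<lambda>k. ereal (op_norm {..<d} (\<lambda>i j. f i j k))"] by simp
      then show "op_norm {..<d} (\<lambda>i j. f i j r) \<le> 1"
        using that order_trans by fastforce
    qed auto
    then show ?thesis
      unfolding l1_space_def cb_norm_def by (auto simp: e_sum intro!: Sup_least)
  qed
  ultimately have "ereal (op_norm ({..<1::nat} \<times> {..<p}) (\<lambda>(i, k) (j, l). \<phi> e k l)) \<le> cb_norm l1_space p \<phi>"
    unfolding cb_norm_def by (intro Sup_upper) (auto intro!: exI[of _ 1] exI[of _ "\<lambda>i j. e"])
  also have "\<dots> \<le> 1"
    using assms by (simp add: complete_contractions_def)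
  finally have "op_norm ({..<1::nat} \<times> {..<p}) (\<lambda>(i, k) (j, l). \<phi> e k l) \<le> 1"
    by simp
  then have "op_norm {..<p} (\<phi> e) \<le> 1"
    by (rule op_norm_le_1_transfer[rotated 2, where h = snd]) (auto simp: bij_betw_def inj_on_def image_def)
  then show ?thesis
    by (simp add: e_def[abs_def])
qed

lemma os_linear_S_inf_sum:
  assumes "os_linear S_inf q \<psi>" "k < q" "l < q" "finite K"
  shows "\<psi> (\<Sum>r\<in>K. cscale (c r) (X r)) k l = (\<Sum>r\<in>K. c r * \<psi> (X r) k l)"
  using assms(4)
proof (induction K rule: finite_induct)
  case empty
  have "\<psi> (cscale 0 0) k l = 0 * \<psi> 0 k l"
    using assms(1-3) by (simp add: os_linear_def S_inf_def)
  then show ?case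
    by (simp add: cscale_def vec_eq_iff flip: zero_vec_def)
next
  case (insert x F)
  then show ?case
    using assms(1-3) by (simp add: os_linear_def S_inf_def)
qed

text \<open>Applying \<open>\<psi>\<close> last reduces the claim to the norm of the matrix
  \<open>x\<close> over \<open>S_inf\<close> obtained from \<open>\<phi>\<close>. Factoring each
  \<open>E a k\<close> through its \<open>D a k\<close> presents \<open>x\<close> as a
  partition-of-unity sum with contractions \<open>\<phi> (e k)\<close> up to sign as
  coefficients.\<close>

lemma min_norm_measurement_le_1:
  fixes E :: "int \<Rightarrow> nat \<Rightarrow> complex^'n^'n"
  assumes "distinct ks" and psd: "\<And>a k. a \<in> {1, -1} \<Longrightarrow> k \<in> set ks \<Longrightarrow> psd (E a k)"
    and sum: "(\<Sum>a\<in>{1, -1}. \<Sum>k\<in>set ks. E a k) = mat 1"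
  shows "min_norm l1_space S_inf
    (map (\<lambda>k. (\<lambda>r. if r = k then 1 else 0, transpose (E 1 k - E (-1) k))) ks) \<le> 1"
  unfolding min_norm_def
proof (rule Sup_least, safe)
  fix p q \<phi> and \<psi> :: "complex^'n^'n \<Rightarrow> nat \<Rightarrow> nat \<Rightarrow> complex"
  assume \<phi>: "\<phi> \<in> complete_contractions l1_space p" and \<psi>: "\<psi> \<in> complete_contractions S_inf q"
  define e where "e k = (\<lambda>r. if r = k then 1 else 0 :: complex)" for k :: nat
  define A where "A k = transpose (E 1 k - E (-1) k)" for k
  define K where "K = set ks"
  define x where "x i j = (\<Sum>k\<in>K. cscale (\<phi> (e k) i j) (A k))" for i j
  have "\<exists>D :: complex^'n^'n. E a k = adjoint_mat D ** D" if "a \<in> {1, -1}" "k \<in> K" for a k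
    using psd_imp_adjoint_mult[OF psd[OF that[unfolded K_def]]] by blast
  then obtain D :: "int \<Rightarrow> nat \<Rightarrow> complex^'n^'n"
    where D: "\<And>a k. a \<in> {1, -1} \<Longrightarrow> k \<in> K \<Longrightarrow> E a k = adjoint_mat (D a k) ** D a k"
    by metis
  have E_nth: "E a k $ j $ i = (\<Sum>m\<in>UNIV. D a k $ m $ i * cnj (D a k $ m $ j))" if "a \<in> {1, -1}" "k \<in> K" for a k i j
    using D[OF that] by (simp add: matrix_matrix_mult_def adjoint_mat_def mult.commute)
  \<comment> \<open>The partition is indexed by sign, message and row of \<open>D a k\<close>. The
    conjugate in \<open>g\<close> produces the transpose in \<open>A\<close>, and the sign of the
    outcome goes into \<open>f\<close>.\<close>
  define R where "R = {1, -1 :: int} \<times> K \<times> (UNIV :: 'n set)"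
  define g where "g = (\<lambda>(a, k, m) l. cnj (D a k $ m $ l))"
  define f where "f = (\<lambda>(a, k, m :: 'n) i j. of_int a * \<phi> (e k) i j)"
  have "op_norm ({..<p} \<times> UNIV) (\<lambda>(i, k) (j, l). \<Sum>r\<in>R. f r i j * (cnj (g r k) * g r l)) \<le> 1"
  proof (rule op_norm_partition_le_1)
    fix r assume "r \<in> R"
    then obtain a k m where r: "r = (a, k, m)" "a = 1 \<or> a = -1"
      by (auto simp: R_def)
    have "op_norm {..<p} (\<phi> (e k)) \<le> 1"
      unfolding e_def by (rule complete_contraction_l1_unit[OF \<phi>])
    then show "op_norm {..<p} (f r) \<le> 1"
      using r op_norm_uminus_le_1[of "{..<p}" "\<phi> (e k)"] by (auto simp: f_def)
  next
    fix k l
    have "(\<Sum>r\<in>R. cnj (g r k) * g r l) = (\<Sum>a\<in>{1, -1}. \<Sum>r\<in>K. E a r $ l $ k)"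
      unfolding R_def sum_Times by (intro sum.cong refl) (simp add: g_def E_nth)
    also have "\<dots> = (\<Sum>a\<in>{1, -1}. \<Sum>r\<in>K. E a r) $ l $ k"
      by simp
    finally show "(\<Sum>r\<in>R. cnj (g r k) * g r l) = (if k = l then 1 else 0)"
      using sum by (auto simp: K_def mat_def)
  qed simp
  moreover have "(\<Sum>r\<in>R. f r i j * (cnj (g r k) * g r l)) = x i j $ k $ l" for i j k l
  proof -
    have "(\<Sum>r\<in>R. f r i j * (cnj (g r k) * g r l))
        = (\<Sum>a\<in>{1, -1}. \<Sum>r\<in>K. of_int a * \<phi> (e r) i j * E a r $ l $ k)"
      unfolding R_def sum_Times
      by (intro sum.cong refl) (simp add: g_def f_def E_nth sum_distrib_left)
    then show ?thesis
      by (simp add: x_def A_def cscale_def transpose_def right_diff_distrib sum_subtractf sum_negf)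
  qed
  ultimately have "os_norm S_inf p x \<le> 1"
    by (simp add: S_inf_def case_prod_unfold)
  then have "ereal (op_norm ({..<p} \<times> {..<q}) (\<lambda>(i, k) (j, l). \<psi> (x i j) k l)) \<le> cb_norm S_inf q \<psi>"
    unfolding cb_norm_def
    by (intro Sup_upper) (auto simp: os_mat_def S_inf_def intro!: exI[of _ p] exI[of _ x])
  also have "\<dots> \<le> 1"
    using \<psi> by (simp add: complete_contractions_def)
  finally have le: "op_norm ({..<p} \<times> {..<q}) (\<lambda>(i, k) (j, l). \<psi> (x i j) k l) \<le> 1"
    by simp
  have lin: "os_linear S_inf q \<psi>"
    using \<psi> by (simp add: complete_contractions_def)
  have "op_norm ({..<p} \<times> {..<q}) (\<lambda>(i, k) (j, l). \<Sum>(x, y)\<leftarrow>map (\<lambda>k. (e k, A k)) ks. \<phi> x i j * \<psi> y k l) \<le> 1"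
  proof (rule op_norm_le_1_cong[OF _ le], simp)
    fix u v assume "u \<in> {..<p} \<times> {..<q}" "v \<in> {..<p} \<times> {..<q}"
    then show "(\<lambda>(i, k) (j, l). \<Sum>(x, y)\<leftarrow>map (\<lambda>k. (e k, A k)) ks. \<phi> x i j * \<psi> y k l) u v
        = (\<lambda>(i, k) (j, l). \<psi> (x i j) k l) u v"
      using assms(1) by (auto simp: x_def os_linear_S_inf_sum[OF lin] K_def o_def sum_list_distinct_conv_sum_set)
  qed
  then show "ereal (op_norm ({..<p} \<times> {..<q}) (\<lambda>(i, k) (j, l).
      \<Sum>(x, y)\<leftarrow>map (\<lambda>k. (\<lambda>r. if r = k then 1 else 0, transpose (E 1 k - E (-1) k))) ks. \<phi> x i j * \<psi> y k l)) \<le> 1"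
    by (simp add: e_def A_def)
qed

lemma sum_list_coordinate_pairing:
  "(\<Sum>(a, x)\<leftarrow>t. (\<Sum>r<N. a r * c r) * x $ i $ j) = (\<Sum>r<N. c r * (\<Sum>(a, x)\<leftarrow>t. cscale (a r) x) $ i $ j)"
  by (induction t) (auto simp: cscale_def sum.distrib algebra_simps sum_distrib_left)

text \<open>The operator is the image of \<open>t\<close> under two complete contractions:
  \<open>\<psi>\<close> is the identity of the matrix algebra in coordinates, and
  \<open>\<phi>\<close> pairs a summable sequence with \<open>C\<close>.\<close>

lemma op_norm_le_1_if_min_norm_le_1:
  fixes t :: "((nat \<Rightarrow> complex) \<times> (complex^'n^'n)) list" and C :: "nat \<Rightarrow> complex^'n^'n"
  assumes t: "min_norm l1_space S_inf t \<le> 1" and C: "\<And>k. k < N \<Longrightarrow> contraction (C k)"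
  shows "op_norm (UNIV \<times> UNIV)
    (\<lambda>(p, i) (q, j). \<Sum>k<N. C k $ p $ q * (\<Sum>(a, x)\<leftarrow>t. cscale (a k) x) $ i $ j) \<le> 1"
proof -
  define n where "n = CARD('n)"
  obtain g :: "nat \<Rightarrow> 'n" where g: "bij_betw g {..<n} UNIV"
    using ex_bij_betw_nat_finite[of "UNIV :: 'n set"] by (auto simp: n_def lessThan_atLeast0)
  define g' where "g' = inv_into {..<n} g"
  have g': "bij_betw g' UNIV {..<n}" and gg': "g (g' i) = i" for i
    using g by (auto simp: g'_def bij_betw_inv_into bij_betw_inv_into_right)
  define \<phi> where "\<phi> a k l = (\<Sum>r<N. a r * C r $ g k $ g l)" for a k l
  define \<psi> :: "complex^'n^'n \<Rightarrow> nat \<Rightarrow> nat \<Rightarrow> complex" where "\<psi> x k l = x $ g k $ g l" for x k l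
  have "\<psi> \<in> complete_contractions S_inf n"
  proof -
    have "op_norm ({..<d} \<times> {..<n}) (\<lambda>(i, k) (j, l). \<psi> (x i j) k l) \<le> 1"
      if "op_norm ({..<d} \<times> UNIV) (\<lambda>(i, k) (j, l). x i j $ k $ l) \<le> 1" for d :: nat and x
      using that
    proof (rule op_norm_le_1_transfer[rotated 2])
      show "bij_betw (map_prod id g') ({..<d} \<times> UNIV) ({..<d} \<times> {..<n})"
        using g' by (intro bij_betw_map_prod) auto
    qed (auto simp: \<psi>_def gg')
    then have "cb_norm S_inf n \<psi> \<le> 1"
      unfolding cb_norm_def by (auto simp: S_inf_def intro!: Sup_least)
    moreover have "os_linear S_inf n \<psi>"
      by (simp add: os_linear_def S_inf_def \<psi>_def cscale_def)
    ultimately show ?thesis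
      by (simp add: complete_contractions_def)
  qed
  moreover have "\<phi> \<in> complete_contractions l1_space n"
  proof -
    \<comment> \<open>The family \<open>C\<close>, padded by 0 so that its entries are null
      sequences, is an element of the unit ball of matrices over \<open>c0_space\<close>.\<close>
    define f where "f k l r = (if r < N then C r $ g k $ g l else 0)" for k l r
    have f_lim: "f k l \<longlonglongrightarrow> 0" for k l
      by (rule tendsto_eventually) (auto simp: f_def eventually_sequentially intro!: exI[of _ N])
    have f_op: "op_norm {..<n} (\<lambda>i j. f i j r) \<le> 1" for r
    proof (cases "r < N")
      case True
      then have "op_norm UNIV (\<lambda>i j. C r $ i $ j) \<le> 1"
        using C contraction_iff_op_norm by blast
      then show ?thesis
        by (rule op_norm_le_1_transfer[OF g', rotated 1]) (auto simp: f_def gg' True)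
    qed (simp add: f_def op_norm_le_1_iff sum_nonneg)
    have f_norm: "f \<in> os_mat c0_space n" "os_norm c0_space n f \<le> 1"
      using f_lim f_op by (auto simp: os_mat_def c0_space_def intro!: SUP_least)
    have "op_norm ({..<d} \<times> {..<n}) (\<lambda>(i, k) (j, l). \<phi> (x i j) k l) \<le> 1"
      if "os_norm l1_space d x \<le> 1" for d x
    proof (rule op_norm_le_1_transfer)
      \<comment> \<open>The norm over \<open>l1_space\<close> tests a matrix of functionals at
        \<open>f\<close>, with the index of \<open>f\<close> first; the amplification of
        \<open>\<phi>\<close> has the two tensor factors in the other order.\<close>
      show "bij_betw prod.swap ({..<n} \<times> {..<d}) ({..<d} \<times> {..<n})"
        by (auto simp: bij_betw_def)
      have "ereal (op_norm ({..<n} \<times> {..<d}) (\<lambda>(i, k) (j, l). \<Sum>r. x k l r * f i j r)) \<le> os_norm l1_space d x"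
        unfolding l1_space_def cb_norm_def using f_norm
        by (simp, intro Sup_upper) (auto intro!: exI[of _ n] exI[of _ f])
      then show "op_norm ({..<n} \<times> {..<d}) (\<lambda>(i, k) (j, l). \<Sum>r. x k l r * f i j r) \<le> 1"
        using that order_trans by fastforce
      have "(\<Sum>r. x k l r * f i j r) = \<phi> (x k l) i j" for i j k l
        using suminf_finite[of "{..<N}" "\<lambda>r. x k l r * f i j r"] by (simp add: f_def \<phi>_def)
      then show "(\<lambda>(i, k) (j, l). \<phi> (x i j) k l) (prod.swap u) (prod.swap v)
          = (\<lambda>(i, k) (j, l). \<Sum>r. x k l r * f i j r) u v" for u v
        by (simp add: case_prod_unfold)
    qed auto
    then have "cb_norm l1_space n \<phi> \<le> 1"
      unfolding cb_norm_def by (auto intro!: Sup_least)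
    moreover have "os_linear l1_space n \<phi>"
      by (simp add: os_linear_def l1_space_def \<phi>_def sum.distrib distrib_right sum_distrib_left mult.assoc)
    ultimately show ?thesis
      by (simp add: complete_contractions_def)
  qed
  ultimately have "ereal (op_norm ({..<n} \<times> {..<n}) (\<lambda>(i, k) (j, l). \<Sum>(x, y)\<leftarrow>t. \<phi> x i j * \<psi> y k l))
      \<le> min_norm l1_space S_inf t"
    unfolding min_norm_def by (intro Sup_upper) blast
  with t have "op_norm ({..<n} \<times> {..<n}) (\<lambda>(i, k) (j, l). \<Sum>(x, y)\<leftarrow>t. \<phi> x i j * \<psi> y k l) \<le> 1"
    using order_trans by fastforce
  then show ?thesis
  proof (rule op_norm_le_1_transfer[rotated 2])
    show "bij_betw (map_prod g g) ({..<n} \<times> {..<n}) (UNIV \<times> UNIV)"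
      using g by (intro bij_betw_map_prod)
  qed (auto simp: \<phi>_def \<psi>_def sum_list_coordinate_pairing)
qed


subsection \<open>Games\<close>

text \<open>The partial trace (id \<otimes> tr)((1 \<otimes> B) G): the operator that the first
  player's observable is paired with once the second player uses \<open>B\<close>.\<close>

definition dual_game :: "complex^('n::finite \<times> 'm::finite)^('n \<times> 'm) \<Rightarrow> complex^'m^'m \<Rightarrow> complex^'n^'n" where
  "dual_game G B = (\<chi> i j. \<Sum>k\<in>UNIV. \<Sum>l\<in>UNIV. B $ k $ l * G $ (i, l) $ (j, k))"

lemma sum_UNIV_prod: "(\<Sum>x\<in>UNIV. h x) = (\<Sum>a\<in>UNIV. \<Sum>b\<in>UNIV. h (a, b))"
  for h :: "'a::finite \<times> 'b::finite \<Rightarrow> 'c::comm_monoid_add"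
  by (simp only: UNIV_Times_UNIV [symmetric] sum_Times)

lemma game_map_nth: "game_map G x $ k $ l = (\<Sum>i\<in>UNIV. \<Sum>j\<in>UNIV. G $ (i, k) $ (j, l) * x $ i $ j)"
  unfolding game_map_def partial_trace_def matrix_matrix_mult_def tensor_mat_def
  by (simp add: sum_UNIV_prod transpose_def mat_def if_distrib [of "\<lambda>x. _ * x"] cong: if_cong)

lemma trace_mult_game_map:
  "trace (B ** game_map G x) = (\<Sum>i\<in>UNIV. \<Sum>j\<in>UNIV. x $ i $ j * dual_game G B $ i $ j)"
proof -
  have "trace (B ** game_map G x)
      = (\<Sum>k\<in>UNIV. \<Sum>l\<in>UNIV. \<Sum>i\<in>UNIV. \<Sum>j\<in>UNIV. x $ i $ j * (B $ k $ l * G $ (i, l) $ (j, k)))"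
    by (simp add: trace_def matrix_matrix_mult_def game_map_nth sum_distrib_left mult_ac)
  also have "\<dots> = (\<Sum>k\<in>UNIV. \<Sum>i\<in>UNIV. \<Sum>j\<in>UNIV. \<Sum>l\<in>UNIV. x $ i $ j * (B $ k $ l * G $ (i, l) $ (j, k)))"
    by (rule sum.cong[OF refl], rule trans[OF sum.swap], rule sum.cong[OF refl], rule sum.swap)
  also have "\<dots> = (\<Sum>i\<in>UNIV. \<Sum>j\<in>UNIV. \<Sum>k\<in>UNIV. \<Sum>l\<in>UNIV. x $ i $ j * (B $ k $ l * G $ (i, l) $ (j, k)))"
    by (rule trans[OF sum.swap], rule sum.cong[OF refl], rule sum.swap)
  finally show ?thesis
    by (simp add: dual_game_def sum_distrib_left)
qed

text \<open>The transpose in \<open>game_map\<close> is the reason why the measurement operators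
  enter the tensor norm transposed.\<close>

lemma trace_tensor_mult: "trace (tensor_mat A B ** G) = trace (B ** game_map G (transpose A))"
proof -
  have "trace (tensor_mat A B ** G)
      = (\<Sum>i\<in>UNIV. \<Sum>k\<in>UNIV. \<Sum>j\<in>UNIV. \<Sum>l\<in>UNIV. A $ i $ j * (B $ k $ l * G $ (j, l) $ (i, k)))"
    by (simp add: trace_def matrix_matrix_mult_def tensor_mat_def sum_UNIV_prod mult_ac)
  also have "\<dots> = (\<Sum>i\<in>UNIV. \<Sum>j\<in>UNIV. \<Sum>k\<in>UNIV. \<Sum>l\<in>UNIV. A $ i $ j * (B $ k $ l * G $ (j, l) $ (i, k)))"
    by (rule sum.cong[OF refl], rule sum.swap)
  also have "\<dots> = (\<Sum>j\<in>UNIV. \<Sum>i\<in>UNIV. \<Sum>k\<in>UNIV. \<Sum>l\<in>UNIV. A $ i $ j * (B $ k $ l * G $ (j, l) $ (i, k)))"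
    by (rule sum.swap)
  finally show ?thesis
    by (simp add: trace_mult_game_map dual_game_def sum_distrib_left transpose_def)
qed

lemma Re_trace_tensor_mult:
  assumes "selfadjoint A"
  shows "Re (trace (tensor_mat A B ** G)) = inner A (dual_game G B)"
proof -
  have "trace (tensor_mat A B ** G) = trace (A ** dual_game G B)"
    unfolding trace_tensor_mult trace_mult_game_map
    by (simp add: trace_def matrix_matrix_mult_def transpose_def, rule sum.swap)
  then show ?thesis
    using assms by (simp add: inner_mat_eq_trace selfadjoint_def)
qed

lemma selfadjoint_dual_game:
  assumes "selfadjoint G" "selfadjoint B"
  shows "selfadjoint (dual_game G B)"
proof -
  have "cnj (dual_game G B $ j $ i) = dual_game G B $ i $ j" for i j
    using sum.swap[of "\<lambda>k l. B $ l $ k * G $ (i, k) $ (j, l)" UNIV UNIV]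
    by (simp add: dual_game_def selfadjoint_nth[OF assms(1)] selfadjoint_nth[OF assms(2)])
  then show ?thesis
    by (simp add: selfadjoint_def adjoint_mat_def vec_eq_iff)
qed

lemma cscale_game_map: "cscale c (game_map G x) = game_map G (cscale c x)"
  by (simp add: vec_eq_iff cscale_def game_map_nth sum_distrib_left mult_ac)

lemma game_map_add: "game_map G (x + y) = game_map G x + game_map G y"
  by (simp add: vec_eq_iff game_map_nth sum.distrib distrib_left)

lemma game_map_zero: "game_map G 0 = 0"
  by (simp add: vec_eq_iff game_map_nth)

lemma sum_list_cscale_game_map:
  "(\<Sum>(a, x)\<leftarrow>t. cscale (a k) (game_map G x)) = game_map G (\<Sum>(a, x)\<leftarrow>t. cscale (a k) x)"
  by (induction t) (auto simp: game_map_zero game_map_add cscale_game_map)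

section \<open>Strategies and the lower bound\<close>

lemma beta_owc_upper:
  fixes E :: "int \<Rightarrow> nat \<Rightarrow> complex^'n::finite^'n" and F :: "int \<Rightarrow> nat \<Rightarrow> complex^'m::finite^'m"
  assumes "\<And>a k. a \<in> {1, -1} \<Longrightarrow> k \<in> {1..2 ^ c} \<Longrightarrow> psd (E a k)"
    and "(\<Sum>a\<in>{1, -1}. \<Sum>k=1..2 ^ c. E a k) = mat 1"
    and "\<And>b k. b \<in> {1, -1} \<Longrightarrow> k \<in> {1..2 ^ c} \<Longrightarrow> psd (F b k)"
    and "\<And>k. k \<in> {1..2 ^ c} \<Longrightarrow> (\<Sum>b\<in>{1, -1}. F b k) = mat 1"
  shows "ereal (\<Sum>k=1..2 ^ c. Re (trace (tensor_mat (E 1 k - E (-1) k) (F 1 k - F (-1) k) ** G))) \<le> beta_owc G"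
  unfolding beta_owc_def
  by (intro Sup_upper CollectI exI[of _ c] exI[of _ E] exI[of _ F] conjI refl ballI) (fact assms)+

lemma psd_imp_selfadjoint: "psd A \<Longrightarrow> selfadjoint A"
  by (simp add: psd_def)

lemma selfadjoint_diff: "selfadjoint A \<Longrightarrow> selfadjoint B \<Longrightarrow> selfadjoint (A - B)"
  by (simp add: selfadjoint_def adjoint_mat_diff)

lemma beta_owc_le_pi_1cb:
  fixes G :: "complex^('n::finite \<times> 'm::finite)^('n \<times> 'm)"
  shows "beta_owc G \<le> pi_1cb (S_inf :: (complex^'n^'n) operator_space) cscale trace_norm (game_map G)"
  unfolding beta_owc_def
proof (rule Sup_least, safe)
  fix c :: nat and E :: "int \<Rightarrow> nat \<Rightarrow> complex^'n^'n" and F :: "int \<Rightarrow> nat \<Rightarrow> complex^'m^'m"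
  assume E: "\<forall>a\<in>{1, - 1}. \<forall>k\<in>{1..2 ^ c}. psd (E a k)" "(\<Sum>a\<in>{1, - 1}. \<Sum>k = 1..2 ^ c. E a k) = mat 1"
    and F: "\<forall>b\<in>{1, - 1}. \<forall>k\<in>{1..2 ^ c}. psd (F b k)" "\<forall>k\<in>{1..2 ^ c}. (\<Sum>b\<in>{1, - 1}. F b k) = mat 1"
  \<comment> \<open>Message \<open>k\<close> occupies coordinate \<open>k\<close> of the sequence,
    starting from 1; all coordinates outside this list are 0.\<close>
  define ks where "ks = [1..<Suc (2 ^ c)]"
  have ks: "distinct ks" "set ks = {1..2 ^ c}"
    by (auto simp: ks_def)
  define A where "A k = transpose (E 1 k - E (-1) k)" for k
  define t where "t = map (\<lambda>k. (\<lambda>r. if r = k then 1 else 0 :: complex, A k)) ks"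
  have t: "min_norm l1_space S_inf t \<le> 1"
    unfolding t_def A_def using E ks(2) by (intro min_norm_measurement_le_1 ks(1)) auto
  have t_sub: "set t \<subseteq> os_carrier l1_space \<times> os_carrier S_inf"
  proof -
    have "summable (\<lambda>r. cmod (if r = k then 1 else 0))" for k :: nat
      using summable_finite[of "{k}" "\<lambda>r. cmod (if r = k then 1 else 0)"] by simp
    then show ?thesis
      by (auto simp: t_def l1_space_def S_inf_def)
  qed
  have t_nth: "(\<Sum>(a, x)\<leftarrow>t. cscale (a r) (game_map G x)) = (if r \<in> set ks then game_map G (A r) else 0)" for r
  proof -
    have "(\<Sum>(a, x)\<leftarrow>t. cscale (a r) (game_map G x)) = (\<Sum>k\<in>set ks. cscale (if r = k then 1 else 0) (game_map G (A k)))"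
      by (simp add: t_def o_def sum_list_distinct_conv_sum_set[OF ks(1)])
    also have "\<dots> = (\<Sum>k\<in>set ks. if r = k then game_map G (A k) else 0)"
      by (intro sum.cong) (auto simp: cscale_def vec_eq_iff)
    finally show ?thesis by simp
  qed
  \<comment> \<open>Needed for the series of trace norms to reduce to a finite sum.\<close>
  have zero: "trace_norm (0 :: complex^'m^'m) = 0"
  proof -
    obtain W :: "complex^'m^'m" where "trace_norm (0 :: complex^'m^'m) = Re (trace (W ** 0))"
      by (rule trace_norm_attained) (rule that)
    then show ?thesis by (simp add: trace_def)
  qed
  have "(\<Sum>k=1..2 ^ c. Re (trace (tensor_mat (E 1 k - E (-1) k) (F 1 k - F (-1) k) ** G)))
      \<le> (\<Sum>k=1..2 ^ c. trace_norm (game_map G (A k)))"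
  proof (rule sum_mono)
    fix k :: nat assume k: "k \<in> {1..2 ^ c}"
    have Fk: "psd (F 1 k)" "psd (F (-1) k)" "F 1 k + F (-1) k = mat 1"
      using F k by auto
    have "contraction (F 1 k - F (-1) k)"
    proof (rule psd_diff_abs_contraction)
      show "selfadjoint (F 1 k - F (-1) k)"
        using Fk by (intro selfadjoint_diff psd_imp_selfadjoint)
      have "mat 1 - (F 1 k - F (-1) k) = 2 *\<^sub>R F (-1) k" "mat 1 + (F 1 k - F (-1) k) = 2 *\<^sub>R F 1 k"
        unfolding Fk(3)[symmetric] by (simp_all add: scaleR_2)
      then show "psd (mat 1 - (F 1 k - F (-1) k))" "psd (mat 1 + (F 1 k - F (-1) k))"
        using Fk(1,2) by (simp_all only:) (auto intro: psd_scaleR)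
    qed
    from norm_trace_mult_le[OF this, of "game_map G (A k)"]
    show "Re (trace (tensor_mat (E 1 k - E (-1) k) (F 1 k - F (-1) k) ** G)) \<le> trace_norm (game_map G (A k))"
      unfolding trace_tensor_mult A_def by (meson complex_Re_le_cmod order_trans)
  qed
  then have "ereal (\<Sum>k=1..2 ^ c. Re (trace (tensor_mat (E 1 k - E (-1) k) (F 1 k - F (-1) k) ** G)))
      \<le> (\<Sum>k\<in>set ks. ereal (trace_norm (\<Sum>(a, x)\<leftarrow>t. cscale (a k) (game_map G x))))"
    by (simp add: t_nth ks(2))
  also have "\<dots> = (\<Sum>k. ereal (trace_norm (\<Sum>(a, x)\<leftarrow>t. cscale (a k) (game_map G x))))"
    by (rule suminf_finite[symmetric]) (auto simp: t_nth zero zero_ereal_def)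
  also have "\<dots> \<le> pi_1cb S_inf cscale trace_norm (game_map G)"
    unfolding pi_1cb_def by (intro Sup_upper CollectI exI[of _ t] conjI refl t t_sub)
  finally show "ereal (\<Sum>k=1..2 ^ c. Re (trace (tensor_mat (E 1 k - E (-1) k) (F 1 k - F (-1) k) ** G)))
      \<le> pi_1cb S_inf cscale trace_norm (game_map G)" .
qed

section \<open>The upper bound\<close>

lemma matrix_vector_mult_uminus: "(- A) *v v = - (A *v v)"
  for A :: "complex^'n^'m"
  by (simp add: matrix_vector_mult_def vec_eq_iff sum_negf)

text \<open>With the observables \<open>B k\<close> of the second player fixed, every measurement of
  the first player gives a strategy of value at most \<open>b\<close>. Duality turns this into a
  matrix \<open>Z\<close> that dominates each \<open>h k\<close> and its negative, and
  \<open>norm_pairing_le\<close> concludes.\<close>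

lemma norm_sum_trace_game_map_le:
  fixes G :: "complex^('n::finite \<times> 'm::finite)^('n \<times> 'm)" and X :: "nat \<Rightarrow> complex^'n^'n"
  assumes "selfadjoint G" "beta_owc G = ereal b"
    and X: "\<And>C :: nat \<Rightarrow> complex^'n^'n. (\<And>k. k < 2 ^ c \<Longrightarrow> contraction (C k)) \<Longrightarrow>
      op_norm (UNIV \<times> UNIV) (\<lambda>(p, i) (q, j). \<Sum>k<2 ^ c. C k $ p $ q * X k $ i $ j) \<le> 1"
    and B: "\<And>k. selfadjoint (B k)" "\<And>k. contraction (B k)"
  shows "cmod (\<Sum>k<2 ^ c. trace (B k ** game_map G (X k))) \<le> b"
proof -
  define J where "J = {1, -1 :: int} \<times> {1..2 ^ c :: nat}"
  \<comment> \<open>Messages in \<open>beta_owc\<close> run from 1 to \<open>2 ^ c\<close>, while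
    the sequence \<open>X\<close> starts at 0; hence the shift.\<close>
  define h where "h k = dual_game G (B (k - 1))" for k :: nat
  define H where "H = (\<lambda>(a :: int, k). of_int a *\<^sub>R h k)"
  have h: "selfadjoint (h k)" for k
    unfolding h_def by (intro selfadjoint_dual_game assms(1) B)
  obtain Z where Z: "inner Z (mat 1) \<le> b" "\<And>j. j \<in> J \<Longrightarrow> psd (Z - H j)"
  proof (rule measurement_duality[of J H b])
    show "finite J" "J \<noteq> {}"
      by (auto simp: J_def Suc_le_eq)
    show "selfadjoint (H j)" for j
      using h by (auto simp: H_def selfadjoint_def adjoint_mat_scaleR split: prod.split)
  next
    fix E :: "int \<times> nat \<Rightarrow> complex^'n^'n"
    assume E: "\<And>j. j \<in> J \<Longrightarrow> psd (E j)" "(\<Sum>j\<in>J. E j) = mat 1"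
    \<comment> \<open>The two-outcome measurement whose observable \<open>F 1 k - F (-1) k\<close>
      is \<open>B (k - 1)\<close>.\<close>
    define F where "F a k = (1 / 2) *\<^sub>R (mat 1 + of_int a *\<^sub>R B (k - 1))" for a :: int and k :: nat
    have F_diff: "F 1 k - F (-1) k = B (k - 1)" for k
    proof -
      have "mat 1 + X - (mat 1 - X) = 2 *\<^sub>R X" for X :: "complex^'m^'m"
        by (simp add: scaleR_2)
      then show ?thesis
        by (simp add: F_def flip: scaleR_diff_right)
    qed
    have "(\<Sum>j\<in>J. inner (E j) (H j)) = (\<Sum>k=1..2 ^ c. inner (E (1, k) - E (-1, k)) (h k))"
      by (simp add: J_def H_def sum_Times inner_diff_left sum_subtractf sum_negf)
    also have "\<dots> = (\<Sum>k=1..2 ^ c. Re (trace (tensor_mat (E (1, k) - E (-1, k)) (F 1 k - F (-1) k) ** G)))"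
      using E(1) by (intro sum.cong refl, subst Re_trace_tensor_mult)
        (auto simp: F_diff h_def J_def intro!: selfadjoint_diff [OF psd_imp_selfadjoint psd_imp_selfadjoint])
    finally have eq: "(\<Sum>j\<in>J. inner (E j) (H j)) = \<dots>" .
    have "ereal (\<Sum>k=1..2 ^ c. Re (trace (tensor_mat (E (1, k) - E (-1, k)) (F 1 k - F (-1) k) ** G))) \<le> beta_owc G"
    proof (rule beta_owc_upper[where E = "\<lambda>a k. E (a, k)"])
      show "psd (E (a, k))" if "a \<in> {1, -1}" "k \<in> {1..2 ^ c}" for a k
        using E(1) that by (simp add: J_def)
      show "(\<Sum>a\<in>{1, -1}. \<Sum>k=1..2 ^ c. E (a, k)) = mat 1"
        using E(2) by (simp only: J_def sum_Times)
      show "psd (F a k)" if "a \<in> {1, -1}" for a k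
      proof -
        have "selfadjoint (- B (k - 1))" "contraction (- B (k - 1))"
          using B by (simp_all add: selfadjoint_def adjoint_mat_minus contraction_def matrix_vector_mult_uminus)
        then show ?thesis
          using that B psd_one_add_contraction[of "- B (k - 1)"] psd_one_add_contraction[of "B (k - 1)"]
          by (auto simp: F_def intro!: psd_scaleR)
      qed
      show "(\<Sum>a\<in>{1, -1}. F a k) = mat 1" for k
        by (simp add: F_def scaleR_diff_right scaleR_add_right flip: scaleR_add_left)
    qed
    then show "(\<Sum>j\<in>J. inner (E j) (H j)) \<le> b"
      by (simp add: eq assms(2))
  qed (rule that)
  have "cmod (\<Sum>k<2 ^ c. \<Sum>i\<in>UNIV. \<Sum>j\<in>UNIV. X k $ i $ j * h (Suc k) $ i $ j) \<le> b"
  proof (rule norm_pairing_le[OF _ X _ _ Z(1)])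
    \<comment> \<open>The two outcomes 1 and -1 of each message give the two bounds on
      \<open>h (Suc k)\<close>.\<close>
    show "psd (Z - h (Suc k))" "psd (Z + h (Suc k))" if "k < 2 ^ c" for k
      using Z(2)[of "(1, Suc k)"] Z(2)[of "(-1, Suc k)"] that by (simp_all add: J_def H_def)
  qed simp_all
  then show ?thesis
    by (simp add: trace_mult_game_map h_def)
qed

section \<open>Real and imaginary parts of a matrix\<close>

definition real_part :: "complex^'n^'n \<Rightarrow> complex^'n^'n" where
  "real_part W = (1 / 2) *\<^sub>R (W + adjoint_mat W)"

definition imag_part :: "complex^'n^'n \<Rightarrow> complex^'n^'n" where
  "imag_part W = cscale (- \<i>) ((1 / 2) *\<^sub>R (W - adjoint_mat W))"

lemma selfadjoint_real_part: "selfadjoint (real_part W)"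
  by (simp add: real_part_def selfadjoint_def adjoint_mat_scaleR adjoint_mat_add add.commute)

lemma selfadjoint_imag_part: "selfadjoint (imag_part W)"
  by (simp add: imag_part_def selfadjoint_def adjoint_mat_def cscale_def vec_eq_iff
      scaleR_conv_of_real[where 'a = complex] algebra_simps)

lemma contraction_real_part:
  assumes "contraction W"
  shows "contraction (real_part W)"
  unfolding contraction_def
proof
  fix v
  have "norm (W *v v + adjoint_mat W *v v) \<le> norm v + norm v"
    using assms contraction_adjoint[OF assms]
    by (intro norm_triangle_mono) (auto simp: contraction_def)
  then show "norm (real_part W *v v) \<le> norm v"
    by (simp add: real_part_def matrix_vector_mult_scaleR_left matrix_vector_mult_add_rdistrib)
qed

lemma contraction_imag_part:
  assumes "contraction W"
  shows "contraction (imag_part W)"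
  unfolding contraction_def
proof
  fix v
  define D where "D = (1 / 2) *\<^sub>R (W - adjoint_mat W)"
  have "imag_part W *v v = (\<chi> i. - \<i> * (D *v v) $ i)"
    by (simp add: imag_part_def D_def[symmetric])
      (simp add: cscale_def matrix_vector_mult_def vec_eq_iff sum_negf sum_distrib_left mult.assoc)
  then have "norm (imag_part W *v v) = norm (D *v v)"
    by (simp add: norm_vec_def norm_mult)
  also have "norm (W *v v - adjoint_mat W *v v) \<le> norm v + norm v"
    using assms contraction_adjoint[OF assms]
    by (intro order_trans[OF norm_triangle_ineq4] add_mono) (auto simp: contraction_def)
  then have "norm (D *v v) \<le> norm v"
    by (simp add: D_def matrix_vector_mult_scaleR_left matrix_vector_mult_diff_rdistrib)
  finally show "norm (imag_part W *v v) \<le> norm v" .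
qed

lemma trace_mult_real_imag_part:
  "trace (W ** Y) = trace (real_part W ** Y) + \<i> * trace (imag_part W ** Y)"
proof -
  have "real_part W + cscale \<i> (imag_part W) = W"
    by (simp add: vec_eq_iff real_part_def imag_part_def cscale_def
        scaleR_conv_of_real[where 'a = complex] field_simps)
  then have "W ** Y = real_part W ** Y + cscale \<i> (imag_part W) ** Y"
    by (simp only: flip: matrix_add_rdistrib)
  also have "cscale \<i> (imag_part W) ** Y = cscale \<i> (imag_part W ** Y)"
    by (simp add: cscale_def matrix_matrix_mult_def vec_eq_iff sum_distrib_left mult.assoc)
  finally show ?thesis
    by (simp add: trace_add) (simp add: trace_def cscale_def sum_distrib_left)
qed

text \<open>The contractions attaining the trace norms need not be selfadjoint. Their real and
  imaginary parts are selfadjoint contractions, and each family contributes at most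
  \<open>b\<close>.\<close>

lemma pi_1cb_le_beta_owc:
  fixes G :: "complex^('n::finite \<times> 'm::finite)^('n \<times> 'm)"
  assumes "selfadjoint G" "beta_owc G = ereal b"
  shows "pi_1cb (S_inf :: (complex^'n^'n) operator_space) cscale trace_norm (game_map G) \<le> ereal (2 * b)"
  unfolding pi_1cb_def
proof (rule Sup_least, safe)
  fix t :: "((nat \<Rightarrow> complex) \<times> (complex^'n^'n)) list"
  assume t: "min_norm l1_space S_inf t \<le> 1"
  define X where "X k = (\<Sum>(a, x)\<leftarrow>t. cscale (a k) x)" for k
  define y where "y k = trace_norm (game_map G (X k))" for k
  define W where "W k = (SOME W. contraction W \<and> y k = Re (trace (W ** game_map G (X k))))" for k
  have W: "contraction (W k) \<and> y k = Re (trace (W k ** game_map G (X k)))" for k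
  proof -
    obtain W' where "contraction W'" "trace_norm (game_map G (X k)) = Re (trace (W' ** game_map G (X k)))"
      by (rule trace_norm_attained)
    then have "contraction W'" "y k = Re (trace (W' ** game_map G (X k)))"
      by (simp_all add: y_def)
    then have "\<exists>W. contraction W \<and> y k = Re (trace (W ** game_map G (X k)))"
      by blast
    from someI_ex[OF this] show ?thesis
      by (simp only: W_def)
  qed
  define B B' where "B k = real_part (W k)" and "B' k = imag_part (W k)" for k
  have y: "y k = Re (trace (B k ** game_map G (X k)) + \<i> * trace (B' k ** game_map G (X k)))" for k
    unfolding B_def B'_def trace_mult_real_imag_part[symmetric] using W by blast
  have le: "cmod (\<Sum>k<2 ^ c. trace (B k ** game_map G (X k))) \<le> b"
    if "\<And>k. selfadjoint (B k)" "\<And>k. contraction (B k)" for B c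
    using that unfolding X_def
    by (intro norm_sum_trace_game_map_le[OF assms] op_norm_le_1_if_min_norm_le_1[OF t])
  have y_nonneg: "0 \<le> y k" for k
    by (simp add: y_def trace_norm_nonneg)
  have bound: "(\<Sum>k<N. y k) \<le> 2 * b" for N
  proof -
    \<comment> \<open>The number of messages is a power of two, so the partial sum is first enlarged
      to \<open>2 ^ N\<close> nonnegative terms.\<close>
    have "(\<Sum>k<N. y k) \<le> (\<Sum>k<2 ^ N. y k)"
      using less_exp[of N] y_nonneg by (intro sum_mono2) auto
    also have "\<dots> = Re ((\<Sum>k<2 ^ N. trace (B k ** game_map G (X k)))
        + \<i> * (\<Sum>k<2 ^ N. trace (B' k ** game_map G (X k))))"
      by (simp only: y sum_distrib_left sum.distrib [symmetric] Re_sum [symmetric])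
    also have "\<dots> \<le> cmod (\<Sum>k<2 ^ N. trace (B k ** game_map G (X k)))
        + cmod (\<i> * (\<Sum>k<2 ^ N. trace (B' k ** game_map G (X k))))"
      by (rule order_trans[OF complex_Re_le_cmod norm_triangle_ineq])
    also have "\<dots> \<le> b + b"
      using W le[of B] le[of B']
      by (intro add_mono) (simp_all add: norm_mult B_def B'_def selfadjoint_real_part
          selfadjoint_imag_part contraction_real_part contraction_imag_part)
    finally show ?thesis by simp
  qed
  have "(\<Sum>k. ereal (y k)) \<le> ereal (2 * b)"
    using bound y_nonneg by (intro suminf_bound) auto
  then show "(\<Sum>k. ereal (trace_norm (\<Sum>(a, x)\<leftarrow>t. cscale (a k) (game_map G x)))) \<le> ereal (2 * b)"
    by (simp add: sum_list_cscale_game_map y_def X_def)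
qed

text \<open>Fair coin flips on both sides, with \<open>c = 0\<close>, have both observables 0 and
  hence value 0.\<close>

lemma beta_owc_nonneg: "0 \<le> beta_owc G"
  for G :: "complex^('n::finite \<times> 'm::finite)^('n \<times> 'm)"
proof -
  define E :: "int \<Rightarrow> nat \<Rightarrow> complex^'n^'n" where "E a k = (1 / 2) *\<^sub>R mat 1" for a k
  define F :: "int \<Rightarrow> nat \<Rightarrow> complex^'m^'m" where "F a k = (1 / 2) *\<^sub>R mat 1" for a k
  have EF: "psd (E a k)" "psd (F a k)" "E a k + E a' k = mat 1" "F a k + F a' k = mat 1" for a a' k
    by (auto simp: E_def F_def simp flip: scaleR_add_left intro!: psd_scaleR psd_one)
  have "ereal (\<Sum>k=1..2 ^ 0. Re (trace (tensor_mat (E 1 k - E (-1) k) (F 1 k - F (-1) k) ** G))) \<le> beta_owc G"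
    by (rule beta_owc_upper) (simp_all add: EF)
  then show ?thesis
    by (simp add: E_def F_def trace_def tensor_mat_def matrix_matrix_mult_def zero_ereal_def)
qed

theorem proposition4p1:
  fixes G :: "complex^('n::finite \<times> 'm::finite)^('n \<times> 'm)"
  assumes "selfadjoint G"
    and "trace_norm G \<le> 1"
  shows "beta_owc G \<le> pi_1cb (S_inf :: (complex^'n^'n) operator_space) cscale trace_norm (game_map G) \<and>
    pi_1cb (S_inf :: (complex^'n^'n) operator_space) cscale trace_norm (game_map G) \<le> 4 * beta_owc G"
proof
  show "beta_owc G \<le> pi_1cb (S_inf :: (complex^'n^'n) operator_space) cscale trace_norm (game_map G)"
    by (rule beta_owc_le_pi_1cb)
  show "pi_1cb (S_inf :: (complex^'n^'n) operator_space) cscale trace_norm (game_map G) \<le> 4 * beta_owc G"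
  \<comment> \<open>In the extended reals an infinite bias makes the claim trivial, and
    nonnegativity excludes \<open>-\<infinity>\<close>; for a finite bias,
    \<open>2 * b \<le> 4 * b\<close> also rests on nonnegativity.\<close>
  proof (cases "beta_owc G")
    case (real b)
    then have "b \<ge> 0"
      using beta_owc_nonneg[of G] by simp
    have "pi_1cb (S_inf :: (complex^'n^'n) operator_space) cscale trace_norm (game_map G) \<le> ereal (2 * b)"
      by (rule pi_1cb_le_beta_owc[OF assms(1) real])
    also have "\<dots> \<le> 4 * beta_owc G"
      using \<open>b \<ge> 0\<close> by (simp add: real)
    finally show ?thesis .
  qed (use beta_owc_nonneg[of G] in auto)
qed

end
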